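(* Let $\Omega\subset\mathbb{R}^2$ be a bounded polygonal domain and let $\{\mathcal{T}_h\}$ be a quasi-uniform family of triangulations of $\Omega$ with characteristic element diameter $h>0$. Let $K$ and $\bar K_{\mathrm{SSE}}$ be the stiffness matrices on $V_h$ of the standard finite element method and of the strain-smoothed element method (SSE), respectively, as defined in the context. Then there exists a positive constant $C$, independent of the mesh size $h$, such that for any preconditioner $M^{-1}$ for $K$ (a symmetric positive definite matrix on the degrees of freedom of $V_h$), $$\kappa(M^{-1}\bar K_{\mathrm{SSE}})\le C\,\kappa(M^{-1}K).$$
   Context: Triangulations are conforming; quasi-uniform means shape-regular with all element diameters comparable to $h$, with constants independent of $h$. $\mathcal{P}_n(\omega)$ is the set of polynomials of degree at most $n$ on $\omega$. $V_h=\{v\in H_0^1(\Omega): v|_e\in\mathcal{P}_1(e)\ \forall e\in\mathcal{T}_h\}$. Functions in $V_h$ are identified with their vectors of nodal degrees of freedom. Standard stiffness matrix: $u^TKv=\int_\Omega\nabla u\cdot\nabla v\,d\Omega$ for $u,v\in V_h$. SSE: let $u\in V_h$ and $e\in\mathcal{T}_h$. Number the edges of $e$ by $k=1,2,3$ and let $e^{(k)}$ be the neighboring element of $e$ across the $k$th edge, if it exists. Set $$\hat\epsilon^{(k)}=\frac{|e|\,\nabla u|_e+|e^{(k)}|\,\nabla u|_{e^{(k)}}}{|e|+|e^{(k)}|}$$ if $e^{(k)}$ exists, and $\hat\epsilon^{(k)}=\nabla u|_e$ otherwise; here $|\cdot|$ denotes area. The smoothed gradient $\bar\nabla_{\mathrm{SSE}}u$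 restricted to $e$ is the (vector-valued) linear polynomial whose values at the three Gaussian integration points $\mathrm{G}1,\mathrm{G}2,\mathrm{G}3$ of $e$ are $$\bar\nabla_{\mathrm{SSE}}u(\mathrm{G}k)=\tfrac12\left(\hat\epsilon^{(k-1)}+\hat\epsilon^{(k)}\right),\qquad \hat\epsilon^{(0)}:=\hat\epsilon^{(3)} .$$ The three-point Gauss rule on $e$ (equal weights $|e|/3$) is exact for quadratic polynomials. The SSE stiffness matrix is given, for $u,v\in V_h$, by $$u^T\bar K_{\mathrm{SSE}}v=\int_\Omega\bar\nabla_{\mathrm{SSE}}u\cdot\bar\nabla_{\mathrm{SSE}}v\,d\Omega=\sum_{e\in\mathcal{T}_h}\frac{|e|}{3}\sum_{k=1}^3\bar\nabla_{\mathrm{SSE}}u|_e(\mathrm{G}k)\cdot\bar\nabla_{\mathrm{SSE}}v|_e(\mathrm{G}k).$$ Condition number: $\kappa(A)=\lambda_{\max}(A)/\lambda_{\min}(A)$, the ratio of the maximum and minimum eigenvalues of $A$; for $A=M^{-1}B$ with $M,B$ symmetric positive definite the eigenvalues are real and positive. *)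

theory Defs
  imports "HOL-Analysis.Analysis" "Jordan_Normal_Form.Spectral_Radius"
begin

type_synonym plane = "real ^ 2"

section \<open>Domains and triangulations\<close>

text \<open>Holes are allowed. The condition that the domain is the interior of its closure excludes
  slits and punctures, i.e. the domain lies on one side of each of its boundary segments.\<close>

definition polygonal_domain :: "plane set \<Rightarrow> bool" where
  "polygonal_domain \<Omega> \<longleftrightarrow>
     \<Omega> \<noteq> {} \<and> open \<Omega> \<and> connected \<Omega> \<and> bounded \<Omega> \<and> interior (closure \<Omega>) = \<Omega> \<and>
     (\<exists>S. finite S \<and> (\<forall>s\<in>S. \<exists>a b. s = closed_segment a b) \<and> frontier \<Omega> = \<Union>S)"

text \<open>Elements are closed nondegenerate triangles; conformity (two elements meet in a common,
  possibly empty, face) is part of the library predicate \<open>triangulation\<close>.\<close>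

definition triangulation_of :: "plane set \<Rightarrow> plane set set \<Rightarrow> bool" where
  "triangulation_of \<Omega> \<T> \<longleftrightarrow>
     triangulation \<T> \<and> (\<forall>e\<in>\<T>. 2 simplex e) \<and> \<Union>\<T> = closure \<Omega>"

definition inscribed_diameter :: "plane set \<Rightarrow> real" where
  "inscribed_diameter e = Sup {2 * r |r. 0 \<le> r \<and> (\<exists>x. cball x r \<subseteq> e)}"

text \<open>A family of triangulations indexed by its mesh sizes \<open>h \<in> H\<close>: shape-regular, and
  with all element diameters comparable to \<open>h\<close>, uniformly in \<open>h\<close>.\<close>

definition quasi_uniform_family ::
  "plane set \<Rightarrow> real set \<Rightarrow> (real \<Rightarrow> plane set set) \<Rightarrow> bool" where
  "quasi_uniform_family \<Omega> H T \<longleftrightarrow>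
     (\<forall>h\<in>H. 0 < h \<and> triangulation_of \<Omega> (T h)) \<and>
     (\<exists>\<sigma>>0. \<forall>h\<in>H. \<forall>e\<in>T h. diameter e \<le> \<sigma> * inscribed_diameter e) \<and>
     (\<exists>c\<^sub>1>0. \<exists>c\<^sub>2>0. \<forall>h\<in>H. \<forall>e\<in>T h. c\<^sub>1 * h \<le> diameter e \<and> diameter e \<le> c\<^sub>2 * h)"

section \<open>The finite element space\<close>

definition grad :: "(plane \<Rightarrow> real) \<Rightarrow> plane \<Rightarrow> plane" where
  "grad f x = (THE D. GDERIV f x :> D)"

definition C1_compact_support :: "plane set \<Rightarrow> (plane \<Rightarrow> real) set" where
  "C1_compact_support \<Omega> =
     {\<phi>. (\<forall>x. \<phi> differentiable (at x)) \<and> continuous_on UNIV (grad \<phi>) \<and>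
         compact (closure {x. \<phi> x \<noteq> 0}) \<and> closure {x. \<phi> x \<noteq> 0} \<subseteq> \<Omega>}"

definition square_integrable_on :: "plane set \<Rightarrow> (plane \<Rightarrow> 'b::euclidean_space) \<Rightarrow> bool" where
  "square_integrable_on \<Omega> f \<longleftrightarrow>
     f \<in> borel_measurable (lebesgue_on \<Omega>) \<and> integrable (lebesgue_on \<Omega>) (\<lambda>x. (norm (f x))\<^sup>2)"

text \<open>\<open>H\<^sub>0\<^sup>1(\<Omega>)\<close> as the closure of the compactly supported continuously differentiable
  functions in the norm of \<open>H\<^sup>1(\<Omega>)\<close> (as in Brezis; smooth test functions give the same
  space). The \<open>L\<^sup>2\<close> limit \<open>g\<close> of the gradients is the weak gradient of \<open>v\<close>.
  Elements are functions rather than classes modulo null sets.\<close>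

definition H10 :: "plane set \<Rightarrow> (plane \<Rightarrow> real) set" where
  "H10 \<Omega> =
     {v. square_integrable_on \<Omega> v \<and>
         (\<exists>g \<phi>. square_integrable_on \<Omega> g \<and>
            (\<forall>n::nat. \<phi> n \<in> C1_compact_support \<Omega>) \<and>
            (\<lambda>n. LINT x|lebesgue_on \<Omega>. (\<phi> n x - v x)\<^sup>2) \<longlonglongrightarrow> 0 \<and>
            (\<lambda>n. LINT x|lebesgue_on \<Omega>. (norm (grad (\<phi> n) x - g x))\<^sup>2) \<longlonglongrightarrow> 0)}"

text \<open>As the elements are closed, the second condition selects the continuous representative.\<close>

definition fe_space :: "plane set \<Rightarrow> plane set set \<Rightarrow> (plane \<Rightarrow> real) set" where
  "fe_space \<Omega> \<T> = {v \<in> H10 \<Omega>. \<forall>e\<in>\<T>. \<exists>g c. \<forall>x\<in>e. v x = inner g x + c}"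

text \<open>Functions in the space vanish on the boundary, so the nodal degrees of freedom are the
  values at the vertices lying in the open set \<open>\<Omega>\<close>.\<close>

definition interior_vertices :: "plane set \<Rightarrow> plane set set \<Rightarrow> plane set" where
  "interior_vertices \<Omega> \<T> = {x \<in> \<Omega>. \<exists>e\<in>\<T>. x extreme_point_of e}"

definition node_enumeration :: "plane set \<Rightarrow> plane set set \<Rightarrow> plane list \<Rightarrow> bool" where
  "node_enumeration \<Omega> \<T> xs \<longleftrightarrow> distinct xs \<and> set xs = interior_vertices \<Omega> \<T>"

definition dofs :: "plane list \<Rightarrow> (plane \<Rightarrow> real) \<Rightarrow> real Matrix.vec" where
  "dofs xs u = vec_of_list (map u xs)"

section \<open>The standard and the strain-smoothed bilinear forms\<close>

definition fem_form :: "plane set \<Rightarrow> (plane \<Rightarrow> real) \<Rightarrow> (plane \<Rightarrow> real) \<Rightarrow> real" where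
  "fem_form \<Omega> u v = (LINT x|lebesgue_on \<Omega>. inner (grad u x) (grad v x))"

definition area :: "plane set \<Rightarrow> real" where
  "area e = measure lebesgue e"

text \<open>The constant value on \<open>e\<close> of the gradient of a function affine on \<open>e\<close>.\<close>

definition elem_grad :: "(plane \<Rightarrow> real) \<Rightarrow> plane set \<Rightarrow> plane" where
  "elem_grad u e = (THE g. \<exists>c. \<forall>x\<in>e. u x = inner g x + c)"

text \<open>A numbering \<open>p e 1, p e 2, p e 3\<close> of the vertices of each element. Edge \<open>k\<close>
  joins \<open>p e k\<close> to the cyclically next vertex, so that edges \<open>k - 1\<close> and \<open>k\<close>
  meet at \<open>p e k\<close>. Every numbering of the three edges arises in this way.\<close>

definition vertex_numbering :: "plane set set \<Rightarrow> (plane set \<Rightarrow> nat \<Rightarrow> plane) \<Rightarrow> bool" where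
  "vertex_numbering \<T> p \<longleftrightarrow> (\<forall>e\<in>\<T>. bij_betw (p e) {1..3} {x. x extreme_point_of e})"

definition edge :: "(plane set \<Rightarrow> nat \<Rightarrow> plane) \<Rightarrow> plane set \<Rightarrow> nat \<Rightarrow> plane set" where
  "edge p e k = closed_segment (p e k) (p e (if k = 3 then 1 else k + 1))"

definition is_neighbor ::
  "plane set set \<Rightarrow> (plane set \<Rightarrow> nat \<Rightarrow> plane) \<Rightarrow> plane set \<Rightarrow> nat \<Rightarrow> plane set \<Rightarrow> bool" where
  "is_neighbor \<T> p e k e' \<longleftrightarrow> e' \<in> \<T> \<and> e' \<noteq> e \<and> e \<inter> e' = edge p e k"

definition edge_strain ::
  "plane set set \<Rightarrow> (plane set \<Rightarrow> nat \<Rightarrow> plane) \<Rightarrow> (plane \<Rightarrow> real) \<Rightarrow> plane set \<Rightarrow> nat \<Rightarrow> plane" where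
  "edge_strain \<T> p u e k =
     (if \<exists>e'. is_neighbor \<T> p e k e'
      then let e' = (THE e'. is_neighbor \<T> p e k e') in
        (1 / (area e + area e')) *\<^sub>R (area e *\<^sub>R elem_grad u e + area e' *\<^sub>R elem_grad u e')
      else elem_grad u e)"

text \<open>The interior three-point rule: barycentric coordinates 2/3 at vertex \<open>k\<close>, 1/6 at the
  other two vertices.\<close>

definition gauss_point :: "(plane set \<Rightarrow> nat \<Rightarrow> plane) \<Rightarrow> plane set \<Rightarrow> nat \<Rightarrow> plane" where
  "gauss_point p e k = (1/2) *\<^sub>R p e k + (1/6) *\<^sub>R (\<Sum>j=1..3. p e j)"

definition sse_gradient ::
  "plane set set \<Rightarrow> (plane set \<Rightarrow> nat \<Rightarrow> plane) \<Rightarrow> (plane \<Rightarrow> real) \<Rightarrow> plane set \<Rightarrow> plane \<Rightarrow> plane" where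
  "sse_gradient \<T> p u e =
     (THE q. (\<exists>A c. linear A \<and> q = (\<lambda>x. A x + c)) \<and>
        (\<forall>k\<in>{1..3}. q (gauss_point p e k) =
           (1/2) *\<^sub>R (edge_strain \<T> p u e (if k = 1 then 3 else k - 1) + edge_strain \<T> p u e k)))"

text \<open>The Gauss rule is exact for the piecewise quadratic integrand, so this is the integral over
  the domain of the inner product of the two smoothed gradients.\<close>

definition sse_form ::
  "plane set set \<Rightarrow> (plane set \<Rightarrow> nat \<Rightarrow> plane) \<Rightarrow> (plane \<Rightarrow> real) \<Rightarrow> (plane \<Rightarrow> real) \<Rightarrow> real" where
  "sse_form \<T> p u v =
     (\<Sum>e\<in>\<T>. area e / 3 *
        (\<Sum>k=1..3. inner (sse_gradient \<T> p u e (gauss_point p e k))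
                        (sse_gradient \<T> p v e (gauss_point p e k))))"

section \<open>Matrices\<close>

definition stiffness_matrix ::
  "(plane \<Rightarrow> real) set \<Rightarrow> plane list \<Rightarrow> ((plane \<Rightarrow> real) \<Rightarrow> (plane \<Rightarrow> real) \<Rightarrow> real) \<Rightarrow>
   real Matrix.mat \<Rightarrow> bool" where
  "stiffness_matrix V xs a K \<longleftrightarrow>
     K \<in> carrier_mat (length xs) (length xs) \<and>
     (\<forall>u\<in>V. \<forall>v\<in>V. scalar_prod (dofs xs u) (mult_mat_vec K (dofs xs v)) = a u v)"

definition spd_mat :: "nat \<Rightarrow> real Matrix.mat \<Rightarrow> bool" where
  "spd_mat n A \<longleftrightarrow>
     A \<in> carrier_mat n n \<and> transpose_mat A = A \<and>
     (\<forall>x\<in>carrier_vec n. x \<noteq> 0\<^sub>v n \<longrightarrow> scalar_prod x (mult_mat_vec A x) > 0)"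

text \<open>Meaningful for nonempty matrices with real eigenvalues only.\<close>

definition cond_number :: "real Matrix.mat \<Rightarrow> real" where
  "cond_number A = Max (spectrum A) / Min (spectrum A)"

end

theory Submission
  imports Defs
begin

text \<open>The two stiffness matrices are spectrally equivalent as quadratic forms, and the Rayleigh
  quotients with respect to the inverse of the preconditioner transfer this to the condition
  numbers. The upper bound is convexity of the squared norm, each element being averaged over at
  most finitely many neighbours. The lower bound is local: the component of the gradient along an
  edge is continuous across that edge, so every smoothed edge value has the same tangential
  component as the gradient on the element; by shape regularity some edge of the triangle sees a
  fixed fraction of the gradient, and the edge values are determined by the averages at the three
  Gauss points. That both matrices are controlled on all vectors of degrees of freedom requires
  that every nodal interpolant vanishing on the boundary lies in \<open>H\<^sub>0\<^sup>1(\<Omega>)\<close>: such a function is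
  Lipschitz and locally affine almost everywhere, and mollifications of its soft thresholds are
  admissible test functions converging to it.\<close>

section \<open>Symmetric positive definite matrices\<close>

text \<open>Averaging over neighbours could cancel a gradient that oscillates from element to
  element, so a lower bound cannot come from averaging alone; the continuity of \<open>u\<close>,
  which confines the jumps to normal components, excludes such cancellation. In the upper bound the
  area weights of the average are exactly what frees the estimate from the ratio of neighbouring
  areas. The final constant is \<open>144 * \<sigma>\<^sup>2\<close>, the quotient of
  \<open>4\<close> and \<open>1 / (36 * \<sigma>\<^sup>2)\<close>, with \<open>\<sigma>\<close> the
  shape-regularity constant. A product of two symmetric matrices need not be symmetric, so its
  eigenvalues are treated as those of the pencil \<open>K x = \<mu> N x\<close>, where
  \<open>N\<close> inverts the preconditioner. \<open>stiffness_matrix\<close> prescribes a matrix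
  only on the degrees of freedom of members of the space; hence not even symmetry can be read off
  before every vector is realised by such a member.\<close>

lemma nonneg_quadratic_discriminant:
  fixes a b c :: real
  assumes pos: "\<And>t. 0 \<le> a + 2 * t * b + t\<^sup>2 * c" and c: "0 \<le> c"
  shows "b\<^sup>2 \<le> a * c"
proof (cases "c = 0")
  case True
  have "b = 0"
  proof (rule ccontr)
    assume "b \<noteq> 0"
    \<comment> \<open>The right-hand side equals -1.\<close>
    have "0 \<le> a + 2 * (- (a + 1) / (2 * b)) * b"
      using pos[of "- (a + 1) / (2 * b)"] True by simp
    with \<open>b \<noteq> 0\<close> show False
      by (simp add: field_simps)
  qed
  with True show ?thesis by simp
next
  case False
  with c have c: "0 < c" by simp
  \<comment> \<open>The point \<open>- b / c\<close> is the minimiser of the quadratic.\<close>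
  have "0 \<le> a + 2 * (- b / c) * b + (- b / c)\<^sup>2 * c" by (rule pos)
  also have "\<dots> = a - b\<^sup>2 / c" using c by (simp add: power2_eq_square field_simps)
  finally show ?thesis using c by (simp add: field_simps)
qed

lemma scalar_prod_self_nonneg:
  fixes x :: "real Matrix.vec"
  shows "0 \<le> scalar_prod x x"
  by (auto simp: scalar_prod_def intro: sum_nonneg)

lemma mat_form_bounded:
  fixes A :: "real Matrix.mat"
  assumes A: "A \<in> carrier_mat n n"
  obtains m where "0 < m"
    "\<And>x. x \<in> carrier_vec n \<Longrightarrow> \<bar>scalar_prod x (A *\<^sub>v x)\<bar> \<le> m * scalar_prod x x"
proof
  \<comment> \<open>A crude entrywise bound; the constant handed out is \<open>m + 1\<close>, which
    is positive for the zero matrix as well.\<close>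
  define m where "m = (\<Sum>i<n. \<Sum>j<n. \<bar>A $$ (i, j)\<bar>)"
  show "0 < m + 1" by (auto simp: m_def intro!: sum_nonneg add_nonneg_pos)
  fix x :: "real Matrix.vec"
  assume x: "x \<in> carrier_vec n"
  define s where "s = scalar_prod x x"
  have le: "\<bar>vec_index x i\<bar> * \<bar>vec_index x j\<bar> \<le> s" if "i < n" "j < n" for i j
  proof -
    have sq: "(vec_index x k)\<^sup>2 \<le> s" if "k < n" for k
      unfolding s_def scalar_prod_def power2_eq_square using that x
      by (intro member_le_sum[where f = "\<lambda>i. vec_index x i * vec_index x i"]) auto
    have "2 * (\<bar>vec_index x i\<bar> * \<bar>vec_index x j\<bar>) \<le> (vec_index x i)\<^sup>2 + (vec_index x j)\<^sup>2"
      using sum_squares_bound[of "\<bar>vec_index x i\<bar>" "\<bar>vec_index x j\<bar>"] by (simp add: mult.assoc)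
    with sq[OF that(1)] sq[OF that(2)] show ?thesis by linarith
  qed
  have "scalar_prod x (A *\<^sub>v x) = (\<Sum>i<n. \<Sum>j<n. vec_index x i * (A $$ (i, j) * vec_index x j))"
    using A x by (simp add: scalar_prod_def mult_mat_vec_def sum_distrib_left lessThan_atLeast0)
  also have "\<bar>\<dots>\<bar> \<le> (\<Sum>i<n. \<Sum>j<n. \<bar>vec_index x i * (A $$ (i, j) * vec_index x j)\<bar>)"
    by (intro order.trans[OF sum_abs] sum_mono sum_abs)
  also have "\<dots> \<le> (\<Sum>i<n. \<Sum>j<n. \<bar>A $$ (i, j)\<bar> * s)"
  proof (intro sum_mono)
    fix i j assume "i \<in> {..<n}" "j \<in> {..<n}"
    then have "\<bar>A $$ (i, j)\<bar> * (\<bar>vec_index x i\<bar> * \<bar>vec_index x j\<bar>) \<le> \<bar>A $$ (i, j)\<bar> * s"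
      by (intro mult_left_mono le) auto
    then show "\<bar>vec_index x i * (A $$ (i, j) * vec_index x j)\<bar> \<le> \<bar>A $$ (i, j)\<bar> * s"
      by (simp add: abs_mult mult.left_commute)
  qed
  also have "\<dots> = m * s" by (simp add: m_def sum_distrib_right)
  also have "\<dots> \<le> (m + 1) * s"
    using scalar_prod_self_nonneg[of x] by (simp add: s_def algebra_simps)
  finally show "\<bar>scalar_prod x (A *\<^sub>v x)\<bar> \<le> (m + 1) * scalar_prod x x" by (simp add: s_def)
qed

lemma symmetric_mat_form_swap:
  fixes A :: "real Matrix.mat"
  assumes A: "A \<in> carrier_mat n n" "transpose_mat A = A" and x: "x \<in> carrier_vec n"
    and y: "y \<in> carrier_vec n"
  shows "scalar_prod y (A *\<^sub>v x) = scalar_prod x (A *\<^sub>v y)"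
  using transpose_vec_mult_scalar[OF A(1) x y] A x y
  by (metis comm_scalar_prod mult_mat_vec_carrier)

text \<open>Along the line \<open>x + t y\<close> the form is a nonnegative quadratic polynomial in
  \<open>t\<close>. The semidefinite version is the right one because it will be applied to
  \<open>\<mu> N - K\<close> at the extreme value of \<open>\<mu>\<close>.\<close>

lemma mat_cauchy_schwarz:
  fixes A :: "real Matrix.mat"
  assumes A: "A \<in> carrier_mat n n" "transpose_mat A = A"
    and psd: "\<And>x. x \<in> carrier_vec n \<Longrightarrow> 0 \<le> scalar_prod x (A *\<^sub>v x)"
    and x: "x \<in> carrier_vec n" and y: "y \<in> carrier_vec n"
  shows "(scalar_prod x (A *\<^sub>v y))\<^sup>2 \<le> scalar_prod x (A *\<^sub>v x) * scalar_prod y (A *\<^sub>v y)"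
proof (rule nonneg_quadratic_discriminant)
  fix t :: real
  have A_lin: "A *\<^sub>v (x + t \<cdot>\<^sub>v y) = A *\<^sub>v x + t \<cdot>\<^sub>v (A *\<^sub>v y)"
    using A(1) x y by (simp add: mult_add_distrib_mat_vec[of A n n] mult_mat_vec[of A n n])
  have carr: "A *\<^sub>v x \<in> carrier_vec n" "t \<cdot>\<^sub>v (A *\<^sub>v y) \<in> carrier_vec n" "t \<cdot>\<^sub>v y \<in> carrier_vec n"
    "A *\<^sub>v y \<in> carrier_vec n"
    using A(1) x y by auto
  have "scalar_prod (x + t \<cdot>\<^sub>v y) (A *\<^sub>v (x + t \<cdot>\<^sub>v y))
      = (scalar_prod x (A *\<^sub>v x) + t * scalar_prod x (A *\<^sub>v y))
        + (t * scalar_prod y (A *\<^sub>v x) + t * (t * scalar_prod y (A *\<^sub>v y)))"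
    unfolding A_lin add_scalar_prod_distrib[OF x carr(3) add_carrier_vec[OF carr(1,2)]]
      scalar_prod_add_distrib[OF x carr(1,2)] scalar_prod_add_distrib[OF carr(3,1,2)]
    using x y carr by simp
  also have "\<dots> = scalar_prod x (A *\<^sub>v x) + 2 * t * scalar_prod x (A *\<^sub>v y)
      + t\<^sup>2 * scalar_prod y (A *\<^sub>v y)"
    using symmetric_mat_form_swap[OF A x y] by (simp add: power2_eq_square)
  finally show "0 \<le> scalar_prod x (A *\<^sub>v x) + 2 * t * scalar_prod x (A *\<^sub>v y)
      + t\<^sup>2 * scalar_prod y (A *\<^sub>v y)"
    using psd[of "x + t \<cdot>\<^sub>v y"] x y by simp
qed (rule psd[OF y])

lemma det_nonzero_inverse:
  fixes A :: "real Matrix.mat"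
  assumes "A \<in> carrier_mat n n" "det A \<noteq> 0"
  obtains B where "B \<in> carrier_mat n n" "A * B = 1\<^sub>m n" "B * A = 1\<^sub>m n"
  using det_non_zero_imp_unit[OF assms, of "()"]
  by (auto simp: Units_def ring_mat_def)

text \<open>With \<open>B\<close> the inverse of \<open>A\<close>, Cauchy-Schwarz for the form of \<open>A\<close> gives
  \<open>(x \<cdot> x)\<^sup>2 = (x \<cdot> A (B x))\<^sup>2 \<le> (x \<cdot> A x) (B x \<cdot> x)\<close>; this replaces a compactness argument.\<close>

lemma psd_nonsingular_coercive:
  fixes A :: "real Matrix.mat"
  assumes A: "A \<in> carrier_mat n n" "transpose_mat A = A"
    and psd: "\<And>x. x \<in> carrier_vec n \<Longrightarrow> 0 \<le> scalar_prod x (A *\<^sub>v x)"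
    and det: "det A \<noteq> 0"
  obtains c where "0 < c"
    "\<And>x. x \<in> carrier_vec n \<Longrightarrow> c * scalar_prod x x \<le> scalar_prod x (A *\<^sub>v x)"
proof -
  obtain B where B: "B \<in> carrier_mat n n" "A * B = 1\<^sub>m n"
    by (rule det_nonzero_inverse[OF A(1) det])
  obtain m where m: "0 < m"
    "\<And>x. x \<in> carrier_vec n \<Longrightarrow> \<bar>scalar_prod x (B *\<^sub>v x)\<bar> \<le> m * scalar_prod x x"
    using mat_form_bounded[OF B(1)] by metis
  show ?thesis
  proof (rule that)
    show "0 < 1 / m" using m by simp
    fix x :: "real Matrix.vec"
    assume x: "x \<in> carrier_vec n"
    have Bx: "B *\<^sub>v x \<in> carrier_vec n" using B x by simp
    have ABx: "A *\<^sub>v (B *\<^sub>v x) = x"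
      using assoc_mult_mat_vec[OF A(1) B(1) x] B x by simp
    have "scalar_prod x x * scalar_prod x x
        \<le> scalar_prod x (A *\<^sub>v x) * scalar_prod (B *\<^sub>v x) x"
      using mat_cauchy_schwarz[OF A psd x Bx] by (simp add: ABx power2_eq_square)
    also have "\<dots> \<le> scalar_prod x (A *\<^sub>v x) * (m * scalar_prod x x)"
      using m(2)[OF x] comm_scalar_prod[OF Bx x] by (intro mult_left_mono psd x) auto
    finally have *: "scalar_prod x x * scalar_prod x x
        \<le> (m * scalar_prod x (A *\<^sub>v x)) * scalar_prod x x"
      by (simp add: algebra_simps)
    have "scalar_prod x x \<le> m * scalar_prod x (A *\<^sub>v x)"
    proof (cases "scalar_prod x x = 0")
      case True
      then show ?thesis using psd[OF x] m by simp
    next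
      case False
      with scalar_prod_self_nonneg[of x] have "0 < scalar_prod x x" by simp
      with * show ?thesis using mult_right_le_imp_le by blast
    qed
    then show "1 / m * scalar_prod x x \<le> scalar_prod x (A *\<^sub>v x)"
      using m by (simp add: field_simps)
  qed
qed

lemma spd_mat_det_nonzero:
  assumes "spd_mat n A"
  shows "det A \<noteq> 0"
proof
  assume "det A = 0"
  then obtain v where v: "v \<in> carrier_vec n" "v \<noteq> 0\<^sub>v n" "A *\<^sub>v v = 0\<^sub>v n"
    using det_0_iff_vec_prod_zero_field[of A n] assms by (auto simp: spd_mat_def)
  then have "scalar_prod v (A *\<^sub>v v) > 0"
    using assms by (auto simp: spd_mat_def)
  with v show False by simp
qed

text \<open>The inverse of the preconditioner supplies the denominator of the Rayleigh quotients.
  Transposing \<open>B * N = 1\<^sub>m n\<close> makes the transpose of \<open>N\<close> a left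
  inverse of \<open>B\<close>, hence equal to \<open>N\<close>; positivity is that of
  \<open>B\<close> at \<open>N x\<close>.\<close>

lemma spd_mat_inverse:
  assumes B: "spd_mat n B"
  obtains N where "spd_mat n N" "B * N = 1\<^sub>m n" "N * B = 1\<^sub>m n"
proof -
  have Bc: "B \<in> carrier_mat n n" and Bt: "transpose_mat B = B"
    using B by (auto simp: spd_mat_def)
  obtain N where N: "N \<in> carrier_mat n n" "B * N = 1\<^sub>m n" "N * B = 1\<^sub>m n"
    by (rule det_nonzero_inverse[OF Bc spd_mat_det_nonzero[OF B]])
  have "transpose_mat N * B = 1\<^sub>m n"
    using transpose_mult[OF Bc N(1)] N(2) Bt by simp
  then have "transpose_mat N * (B * N) = N"
    using assoc_mult_mat[of "transpose_mat N" n n B n N n] N Bc by simp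
  then have Nt: "transpose_mat N = N" using N by simp
  have "scalar_prod x (N *\<^sub>v x) > 0" if x: "x \<in> carrier_vec n" "x \<noteq> 0\<^sub>v n" for x
  proof -
    have Nx: "N *\<^sub>v x \<in> carrier_vec n" using N x by simp
    have BNx: "B *\<^sub>v (N *\<^sub>v x) = x"
      using assoc_mult_mat_vec[OF Bc N(1) x(1)] N x by simp
    have "N *\<^sub>v x \<noteq> 0\<^sub>v n"
    proof
      assume "N *\<^sub>v x = 0\<^sub>v n"
      then have "B *\<^sub>v (N *\<^sub>v x) = 0\<^sub>v n"
        using Bc by (auto intro!: eq_vecI)
      with BNx x show False by simp
    qed
    with B Nx have "0 < scalar_prod (N *\<^sub>v x) (B *\<^sub>v (N *\<^sub>v x))" by (auto simp: spd_mat_def)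
    then show ?thesis unfolding BNx using comm_scalar_prod[OF x(1) Nx] by simp
  qed
  with that N Nt show ?thesis by (auto simp: spd_mat_def)
qed

section \<open>Extreme eigenvalues of a symmetric pencil\<close>

lemma smult_minus_form:
  fixes N K :: "real Matrix.mat"
  assumes "N \<in> carrier_mat n n" "K \<in> carrier_mat n n" "y \<in> carrier_vec n"
  shows "(s \<cdot>\<^sub>m N - K) *\<^sub>v y = s \<cdot>\<^sub>v (N *\<^sub>v y) - K *\<^sub>v y"
    and "scalar_prod y ((s \<cdot>\<^sub>m N - K) *\<^sub>v y)
      = s * scalar_prod y (N *\<^sub>v y) - scalar_prod y (K *\<^sub>v y)"
proof -
  show *: "(s \<cdot>\<^sub>m N - K) *\<^sub>v y = s \<cdot>\<^sub>v (N *\<^sub>v y) - K *\<^sub>v y"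
    using assms
    by (intro eq_vecI) (auto simp: scalar_prod_def left_diff_distrib sum_subtractf sum_distrib_left mult.assoc)
  show "scalar_prod y ((s \<cdot>\<^sub>m N - K) *\<^sub>v y)
      = s * scalar_prod y (N *\<^sub>v y) - scalar_prod y (K *\<^sub>v y)"
    unfolding * using assms by (simp add: scalar_prod_minus_distrib[of _ n])
qed

text \<open>The largest eigenvalue of the pencil is the least \<open>s\<close> for which \<open>s N - K\<close> is positive
  semidefinite: were that matrix nonsingular, it would be coercive, and \<open>s\<close> could be decreased.\<close>

lemma pencil_extreme_eigenvalue:
  assumes n: "0 < n" and N: "spd_mat n N"
    and K: "K \<in> carrier_mat n n" "transpose_mat K = K"
  obtains \<mu> x where "x \<in> carrier_vec n" "x \<noteq> 0\<^sub>v n" "K *\<^sub>v x = \<mu> \<cdot>\<^sub>v (N *\<^sub>v x)"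
    "\<And>y. y \<in> carrier_vec n \<Longrightarrow> scalar_prod y (K *\<^sub>v y) \<le> \<mu> * scalar_prod y (N *\<^sub>v y)"
proof -
  have Nc: "N \<in> carrier_mat n n" and Nt: "transpose_mat N = N"
    using N by (auto simp: spd_mat_def)
  have Npos: "0 < scalar_prod x (N *\<^sub>v x)" if "x \<in> carrier_vec n" "x \<noteq> 0\<^sub>v n" for x
    using N that by (auto simp: spd_mat_def)
  have Nnn: "0 \<le> scalar_prod x (N *\<^sub>v x)" if "x \<in> carrier_vec n" for x
    using Npos[OF that] Nc by (cases "x = 0\<^sub>v n") auto
  obtain c where c: "0 < c"
    "\<And>x. x \<in> carrier_vec n \<Longrightarrow> c * scalar_prod x x \<le> scalar_prod x (N *\<^sub>v x)"
    using psd_nonsingular_coercive[OF Nc Nt Nnn spd_mat_det_nonzero[OF N]] by metis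
  obtain mN where mN: "0 < mN"
    "\<And>x. x \<in> carrier_vec n \<Longrightarrow> \<bar>scalar_prod x (N *\<^sub>v x)\<bar> \<le> mN * scalar_prod x x"
    using mat_form_bounded[OF Nc] by metis
  obtain mK where mK: "0 < mK"
    "\<And>x. x \<in> carrier_vec n \<Longrightarrow> \<bar>scalar_prod x (K *\<^sub>v x)\<bar> \<le> mK * scalar_prod x x"
    using mat_form_bounded[OF K(1)] by metis
  \<comment> \<open>The infimum of \<open>S\<close> will be the eigenvalue. Coercivity of
    \<open>N\<close> together with boundedness of \<open>K\<close> puts \<open>mK / c\<close> into
    \<open>S\<close>.\<close>
  define S where "S = {s. \<forall>y\<in>carrier_vec n. scalar_prod y (K *\<^sub>v y) \<le> s * scalar_prod y (N *\<^sub>v y)}"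
  define \<mu> where "\<mu> = Inf S"
  have "mK / c \<in> S"
    unfolding S_def
  proof clarify
    fix y :: "real Matrix.vec"
    assume y: "y \<in> carrier_vec n"
    have "scalar_prod y (K *\<^sub>v y) \<le> mK / c * (c * scalar_prod y y)"
      using mK(2)[OF y] c by simp
    also have "\<dots> \<le> mK / c * scalar_prod y (N *\<^sub>v y)"
      using c mK y by (intro mult_left_mono) auto
    finally show "scalar_prod y (K *\<^sub>v y) \<le> mK / c * scalar_prod y (N *\<^sub>v y)" .
  qed
  then have ne: "S \<noteq> {}" by blast
  have bound: "scalar_prod y (K *\<^sub>v y) / scalar_prod y (N *\<^sub>v y) \<le> s"
    if "s \<in> S" "y \<in> carrier_vec n" "y \<noteq> 0\<^sub>v n" for s y
    using that Npos[of y] by (auto simp: S_def field_simps)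
  \<comment> \<open>Since \<open>0 < n\<close> there is a nonzero vector, and its Rayleigh quotient
    bounds \<open>S\<close> from below.\<close>
  have "unit_vec n 0 \<noteq> (0\<^sub>v n :: real Matrix.vec)"
    using n by (metis index_unit_vec(1) index_zero_vec(1) zero_neq_one)
  with bound[of _ "unit_vec n 0"] have bdd: "bdd_below S"
    by (intro bdd_belowI) auto
  have \<mu>: "scalar_prod y (K *\<^sub>v y) \<le> \<mu> * scalar_prod y (N *\<^sub>v y)" if y: "y \<in> carrier_vec n" for y
  proof (cases "y = 0\<^sub>v n")
    case True
    then show ?thesis using K Nc by simp
  next
    case False
    have "scalar_prod y (K *\<^sub>v y) / scalar_prod y (N *\<^sub>v y) \<le> \<mu>"
      unfolding \<mu>_def using ne bound y False by (intro cInf_greatest) auto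
    then show ?thesis using Npos[OF y False] by (simp add: field_simps)
  qed
  define A where "A = \<mu> \<cdot>\<^sub>m N - K"
  have A: "A \<in> carrier_mat n n" "transpose_mat A = A"
  proof -
    show "A \<in> carrier_mat n n" using K(1) unfolding A_def by (rule minus_carrier_mat)
    have "transpose_mat (\<mu> \<cdot>\<^sub>m N) = \<mu> \<cdot>\<^sub>m transpose_mat N" by (intro eq_matI) auto
    then show "transpose_mat A = A"
      using K Nc Nt by (simp add: A_def transpose_minus[of _ n n])
  qed
  have Aform: "scalar_prod y (A *\<^sub>v y) = \<mu> * scalar_prod y (N *\<^sub>v y) - scalar_prod y (K *\<^sub>v y)"
    if "y \<in> carrier_vec n" for y
    unfolding A_def by (rule smult_minus_form[OF Nc K(1) that])
  have psd: "0 \<le> scalar_prod y (A *\<^sub>v y)" if "y \<in> carrier_vec n" for y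
    using \<mu>[OF that] Aform[OF that] by simp
  have "det A = 0"
  proof (rule ccontr)
    assume det: "det A \<noteq> 0"
    obtain d where d: "0 < d"
      "\<And>x. x \<in> carrier_vec n \<Longrightarrow> d * scalar_prod x x \<le> scalar_prod x (A *\<^sub>v x)"
      using psd_nonsingular_coercive[OF A psd det] by metis
    \<comment> \<open>The form of \<open>A\<close> is at least \<open>d\<close> times the squared
      length and that of \<open>N\<close> at most \<open>mN\<close> times it, so \<open>A\<close>
      dominates \<open>d / mN\<close> times \<open>N\<close>: this is the room for lowering
      \<open>\<mu>\<close>.\<close>
    have "\<mu> - d / mN \<in> S"
      unfolding S_def
    proof clarify
      fix y :: "real Matrix.vec"
      assume y: "y \<in> carrier_vec n"
      have "d / mN * scalar_prod y (N *\<^sub>v y) \<le> d / mN * (mN * scalar_prod y y)"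
        using mN(2)[OF y] d mN by (intro mult_left_mono) auto
      also have "\<dots> \<le> \<mu> * scalar_prod y (N *\<^sub>v y) - scalar_prod y (K *\<^sub>v y)"
        using d(2)[OF y] mN(1) Aform[OF y] by simp
      finally show "scalar_prod y (K *\<^sub>v y) \<le> (\<mu> - d / mN) * scalar_prod y (N *\<^sub>v y)"
        by (simp add: algebra_simps)
    qed
    then have "\<mu> \<le> \<mu> - d / mN"
      unfolding \<mu>_def by (intro cInf_lower bdd)
    moreover have "0 < d / mN" using d mN by simp
    ultimately show False by simp
  qed
  then obtain x where x: "x \<in> carrier_vec n" "x \<noteq> 0\<^sub>v n" "A *\<^sub>v x = 0\<^sub>v n"
    using det_0_iff_vec_prod_zero_field[OF A(1)] by blast
  have "\<mu> \<cdot>\<^sub>v (N *\<^sub>v x) - K *\<^sub>v x = 0\<^sub>v n"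
    using x smult_minus_form(1)[OF Nc K(1) x(1), of \<mu>] by (simp add: A_def)
  then have "K *\<^sub>v x = \<mu> \<cdot>\<^sub>v (N *\<^sub>v x)"
    using x K Nc by (auto simp: vec_eq_iff)
  with x \<mu> that show ?thesis by blast
qed

text \<open>Multiplication by \<open>N\<close> and by \<open>B\<close> passes between the possibly
  nonsymmetric product and a pencil of symmetric matrices, to which variational arguments
  apply.\<close>

lemma eigenvalue_preconditioned_iff:
  assumes B: "spd_mat n B" and N: "spd_mat n N" "B * N = 1\<^sub>m n" "N * B = 1\<^sub>m n"
    and K: "K \<in> carrier_mat n n"
  shows "\<mu> \<in> spectrum (B * K) \<longleftrightarrow>
    (\<exists>x\<in>carrier_vec n. x \<noteq> 0\<^sub>v n \<and> K *\<^sub>v x = \<mu> \<cdot>\<^sub>v (N *\<^sub>v x))"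
proof -
  have Bc: "B \<in> carrier_mat n n" and Nc: "N \<in> carrier_mat n n"
    using B N by (auto simp: spd_mat_def)
  have "(B * K) *\<^sub>v x = \<mu> \<cdot>\<^sub>v x \<longleftrightarrow> K *\<^sub>v x = \<mu> \<cdot>\<^sub>v (N *\<^sub>v x)" if x: "x \<in> carrier_vec n" for x
  proof
    assume *: "(B * K) *\<^sub>v x = \<mu> \<cdot>\<^sub>v x"
    have "K *\<^sub>v x = (N * B) *\<^sub>v (K *\<^sub>v x)"
      using K x N by simp
    also have "\<dots> = N *\<^sub>v ((B * K) *\<^sub>v x)"
      using K x Nc Bc by (simp add: assoc_mult_mat_vec[of _ n n _ n])
    finally show "K *\<^sub>v x = \<mu> \<cdot>\<^sub>v (N *\<^sub>v x)"
      using * Nc x by (simp add: mult_mat_vec[of _ n n])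
  next
    assume *: "K *\<^sub>v x = \<mu> \<cdot>\<^sub>v (N *\<^sub>v x)"
    have "(B * K) *\<^sub>v x = B *\<^sub>v (K *\<^sub>v x)"
      using K x Bc by (simp add: assoc_mult_mat_vec[of _ n n _ n])
    also have "\<dots> = \<mu> \<cdot>\<^sub>v ((B * N) *\<^sub>v x)"
      using * Nc Bc x by (simp add: mult_mat_vec[of _ n n] assoc_mult_mat_vec[of _ n n _ n])
    finally show "(B * K) *\<^sub>v x = \<mu> \<cdot>\<^sub>v x" using N x by simp
  qed
  moreover have "dim_row (B * K) = n" using Bc by simp
  ultimately show ?thesis
    by (auto simp: spectrum_def eigenvalue_def eigenvector_def)
qed

text \<open>The pencil with \<open>K\<close> yields the upper estimate and the pencil with
  \<open>- K\<close> the lower one. Both produce actual eigenvalues, so the spectrum is nonempty and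
  \<open>Max\<close> and \<open>Min\<close> are meaningful.\<close>

lemma preconditioned_spectrum_extremes:
  assumes n: "0 < n" and B: "spd_mat n B" and N: "spd_mat n N" "B * N = 1\<^sub>m n" "N * B = 1\<^sub>m n"
    and K: "K \<in> carrier_mat n n" "transpose_mat K = K"
  shows "Max (spectrum (B * K)) \<in> spectrum (B * K)" "Min (spectrum (B * K)) \<in> spectrum (B * K)"
    and "\<And>y. y \<in> carrier_vec n \<Longrightarrow>
      scalar_prod y (K *\<^sub>v y) \<le> Max (spectrum (B * K)) * scalar_prod y (N *\<^sub>v y)"
    and "\<And>y. y \<in> carrier_vec n \<Longrightarrow>
      Min (spectrum (B * K)) * scalar_prod y (N *\<^sub>v y) \<le> scalar_prod y (K *\<^sub>v y)"
proof -
  note ev = eigenvalue_preconditioned_iff[OF B N K(1)]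
  have Bc: "B \<in> carrier_mat n n" and Nc: "N \<in> carrier_mat n n"
    using B N by (auto simp: spd_mat_def)
  have Nnn: "0 \<le> scalar_prod x (N *\<^sub>v x)" if "x \<in> carrier_vec n" for x
    using N(1) that Nc by (cases "x = 0\<^sub>v n") (auto simp: spd_mat_def less_imp_le)
  have fin: "finite (spectrum (B * K))"
    using card_finite_spectrum(1)[of "B * K" n] Bc K by simp
  obtain \<mu> x where \<mu>: "x \<in> carrier_vec n" "x \<noteq> 0\<^sub>v n" "K *\<^sub>v x = \<mu> \<cdot>\<^sub>v (N *\<^sub>v x)"
    "\<And>y. y \<in> carrier_vec n \<Longrightarrow> scalar_prod y (K *\<^sub>v y) \<le> \<mu> * scalar_prod y (N *\<^sub>v y)"
    using pencil_extreme_eigenvalue[OF n N(1) K] by metis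
  have \<mu>s: "\<mu> \<in> spectrum (B * K)" using ev \<mu> by blast
  have K': "- K \<in> carrier_mat n n" "transpose_mat (- K) = - K"
    using K by (auto simp: transpose_uminus)
  obtain \<nu> z where \<nu>: "z \<in> carrier_vec n" "z \<noteq> 0\<^sub>v n" "(- K) *\<^sub>v z = \<nu> \<cdot>\<^sub>v (N *\<^sub>v z)"
    "\<And>y. y \<in> carrier_vec n \<Longrightarrow> scalar_prod y ((- K) *\<^sub>v y) \<le> \<nu> * scalar_prod y (N *\<^sub>v y)"
    using pencil_extreme_eigenvalue[OF n N(1) K'] by metis
  have neg: "(- K) *\<^sub>v y = - (K *\<^sub>v y)" if "y \<in> carrier_vec n" for y
    using K that by (simp add: uminus_mult_mat_vec)
  have "K *\<^sub>v z = (- \<nu>) \<cdot>\<^sub>v (N *\<^sub>v z)"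
    using \<nu>(3) neg[OF \<nu>(1)] K Nc \<nu>(1) by (auto simp: vec_eq_iff)
  then have \<nu>s: "- \<nu> \<in> spectrum (B * K)" using ev \<nu> by blast
  show "Max (spectrum (B * K)) \<in> spectrum (B * K)" "Min (spectrum (B * K)) \<in> spectrum (B * K)"
    using fin \<mu>s by (auto intro: Max_in Min_in)
  fix y :: "real Matrix.vec"
  assume y: "y \<in> carrier_vec n"
  show "scalar_prod y (K *\<^sub>v y) \<le> Max (spectrum (B * K)) * scalar_prod y (N *\<^sub>v y)"
    using \<mu>(4)[OF y] mult_right_mono[OF Max_ge[OF fin \<mu>s] Nnn[OF y]] by linarith
  have "- scalar_prod y (K *\<^sub>v y) \<le> \<nu> * scalar_prod y (N *\<^sub>v y)"
    using \<nu>(4)[OF y] neg[OF y] y K by (simp add: scalar_prod_uminus_right)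
  then show "Min (spectrum (B * K)) * scalar_prod y (N *\<^sub>v y) \<le> scalar_prod y (K *\<^sub>v y)"
    using mult_right_mono[OF Min_le[OF fin \<nu>s] Nnn[OF y]] by linarith
qed

text \<open>An extreme eigenvalue of one pencil is a Rayleigh quotient at its eigenvector. Comparing
  the two forms at that vector, and then using the extremal bounds of the other pencil, gives
  \<open>M' \<le> c\<^sub>2 * M\<close> and \<open>c\<^sub>1 * m \<le> m'\<close>.\<close>

lemma cond_number_spectrally_equivalent:
  assumes n: "0 < n" and B: "spd_mat n B"
    and K: "K \<in> carrier_mat n n" "transpose_mat K = K"
    and K': "K' \<in> carrier_mat n n" "transpose_mat K' = K'"
    and c: "0 < c\<^sub>1" "0 < c\<^sub>2"
    and psd: "\<And>x. x \<in> carrier_vec n \<Longrightarrow> 0 \<le> scalar_prod x (K *\<^sub>v x)"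
    and lower: "\<And>x. x \<in> carrier_vec n \<Longrightarrow>
      c\<^sub>1 * scalar_prod x (K *\<^sub>v x) \<le> scalar_prod x (K' *\<^sub>v x)"
    and upper: "\<And>x. x \<in> carrier_vec n \<Longrightarrow>
      scalar_prod x (K' *\<^sub>v x) \<le> c\<^sub>2 * scalar_prod x (K *\<^sub>v x)"
  shows "cond_number (B * K') \<le> c\<^sub>2 / c\<^sub>1 * cond_number (B * K)"
proof -
  obtain N where N: "spd_mat n N" "B * N = 1\<^sub>m n" "N * B = 1\<^sub>m n"
    by (rule spd_mat_inverse[OF B])
  note ext = preconditioned_spectrum_extremes[OF n B N K]
  note ext' = preconditioned_spectrum_extremes[OF n B N K']
  have Npos: "0 < scalar_prod x (N *\<^sub>v x)" if "x \<in> carrier_vec n" "x \<noteq> 0\<^sub>v n" for x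
    using N that by (auto simp: spd_mat_def)
  have rayleigh: "\<exists>x\<in>carrier_vec n. 0 < scalar_prod x (N *\<^sub>v x) \<and>
      scalar_prod x (A *\<^sub>v x) = s * scalar_prod x (N *\<^sub>v x)"
    if A: "A \<in> carrier_mat n n" and s: "s \<in> spectrum (B * A)" for A s
  proof -
    obtain x where x: "x \<in> carrier_vec n" "x \<noteq> 0\<^sub>v n" "A *\<^sub>v x = s \<cdot>\<^sub>v (N *\<^sub>v x)"
      using s unfolding eigenvalue_preconditioned_iff[OF B N A] by metis
    have "N *\<^sub>v x \<in> carrier_vec n"
      using N x by (auto simp: spd_mat_def)
    with x Npos[OF x(1,2)] show ?thesis by auto
  qed
  define M m M' m' where "M = Max (spectrum (B * K))" and "m = Min (spectrum (B * K))"
    and "M' = Max (spectrum (B * K'))" and "m' = Min (spectrum (B * K'))"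
  have m: "0 \<le> m"
  proof -
    obtain x where x: "x \<in> carrier_vec n" "0 < scalar_prod x (N *\<^sub>v x)"
      "scalar_prod x (K *\<^sub>v x) = m * scalar_prod x (N *\<^sub>v x)"
      using rayleigh[OF K(1) ext(2)] by (auto simp: m_def)
    then show ?thesis using psd[OF x(1)] by (simp add: zero_le_mult_iff)
  qed
  have mM: "m \<le> M"
    unfolding m_def M_def using card_finite_spectrum(1)[of "B * K" n] B K ext(1)
    by (intro Min_le) (auto simp: spd_mat_def)
  have M': "M' \<le> c\<^sub>2 * M"
  proof -
    obtain x where x: "x \<in> carrier_vec n" "0 < scalar_prod x (N *\<^sub>v x)"
      "scalar_prod x (K' *\<^sub>v x) = M' * scalar_prod x (N *\<^sub>v x)"
      using rayleigh[OF K'(1) ext'(1)] by (auto simp: M'_def)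
    have "M' * scalar_prod x (N *\<^sub>v x) \<le> c\<^sub>2 * scalar_prod x (K *\<^sub>v x)"
      using upper[OF x(1)] x by simp
    also have "\<dots> \<le> c\<^sub>2 * (M * scalar_prod x (N *\<^sub>v x))"
      unfolding M_def using ext(3) c x by (intro mult_left_mono) auto
    finally show ?thesis using x by (simp flip: mult.assoc)
  qed
  have m': "c\<^sub>1 * m \<le> m'"
  proof -
    obtain x where x: "x \<in> carrier_vec n" "0 < scalar_prod x (N *\<^sub>v x)"
      "scalar_prod x (K' *\<^sub>v x) = m' * scalar_prod x (N *\<^sub>v x)"
      using rayleigh[OF K'(1) ext'(2)] by (auto simp: m'_def)
    have "c\<^sub>1 * (m * scalar_prod x (N *\<^sub>v x)) \<le> c\<^sub>1 * scalar_prod x (K *\<^sub>v x)"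
      unfolding m_def using ext(4) c x by (intro mult_left_mono) auto
    also have "\<dots> \<le> m' * scalar_prod x (N *\<^sub>v x)"
      using lower[OF x(1)] x by simp
    finally show ?thesis using x by (simp flip: mult.assoc)
  qed
  show ?thesis
  proof (cases "m = 0")
    case True
    \<comment> \<open>\<open>K'\<close> is singular as well, and both condition numbers are 0 because \<open>x / 0 = 0\<close>.\<close>
    obtain x where x: "x \<in> carrier_vec n" "0 < scalar_prod x (N *\<^sub>v x)"
      "scalar_prod x (K *\<^sub>v x) = m * scalar_prod x (N *\<^sub>v x)"
      using rayleigh[OF K(1) ext(2)] by (auto simp: m_def)
    have "m' * scalar_prod x (N *\<^sub>v x) \<le> 0"
      using ext'(4)[OF x(1)] upper[OF x(1)] x True by (simp add: m'_def)
    then have "m' \<le> 0" using x by (simp add: mult_le_0_iff)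
    with m' True have "m' = 0" by simp
    with True show ?thesis by (simp add: cond_number_def m_def m'_def)
  next
    case False
    with m have m: "0 < m" by simp
    have cm: "0 < c\<^sub>1 * m" using c(1) m by (rule mult_pos_pos)
    have m'_pos: "0 < m'" using cm m' by linarith
    have cM: "0 \<le> c\<^sub>2 * M" using c m mM by simp
    have "M' / m' \<le> (c\<^sub>2 * M) / m'"
      using M' m'_pos by (intro divide_right_mono) auto
    also have "\<dots> \<le> (c\<^sub>2 * M) / (c\<^sub>1 * m)"
      by (rule divide_left_mono[OF m' cM mult_pos_pos[OF m'_pos cm]])
    finally have "M' / m' \<le> c\<^sub>2 / c\<^sub>1 * (M / m)" by simp
    then show ?thesis unfolding cond_number_def M_def m_def M'_def m'_def .
  qed
qed

section \<open>Triangles and triangulations\<close>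

lemma two_simplex_vertices:
  fixes e :: "plane set"
  assumes "2 simplex e"
  obtains C where "\<not> affine_dependent C" "card C = 3" "finite C" "e = convex hull C"
    "C = {x. x extreme_point_of e}"
proof -
  obtain C where C: "\<not> affine_dependent C" "int (card C) = 2 + 1" "e = convex hull C"
    using assms unfolding simplex_def by blast
  show ?thesis
  proof (rule that[of C])
    show "C = {x. x extreme_point_of e}"
      unfolding C(3) using extreme_point_of_convex_hull_affine_independent[OF C(1)] by blast
  qed (use C aff_independent_finite in auto)
qed

lemma two_simplex_interior:
  fixes e :: "plane set"
  assumes "2 simplex e"
  shows "interior e \<noteq> {}"
proof -
  have "aff_dim e = int DIM(plane)"
    using aff_dim_simplex[OF assms] by simp
  then have "rel_interior e = interior e"
    by (simp add: interior_rel_interior_gen)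
  moreover have "e \<noteq> {}" using assms by auto
  ultimately show ?thesis
    using rel_interior_eq_empty[OF convex_simplex[OF assms]] by simp
qed

lemma two_simplex_measure_pos:
  fixes e :: "plane set"
  assumes "2 simplex e"
  shows "0 < area e"
proof -
  obtain x r where r: "0 < r" "ball x r \<subseteq> e"
    using two_simplex_interior[OF assms] by (meson all_not_in_conv mem_interior)
  have "measure lebesgue (ball x r) \<le> measure lebesgue e"
    using r compact_simplex[OF assms] by (intro measure_mono_fmeasurable) (auto intro: lmeasurable_compact)
  moreover have "0 < measure lebesgue (ball x r)"
    using content_ball_pos[OF r(1), of x] by simp
  ultimately show ?thesis unfolding area_def by linarith
qed

lemma affine_function_gradient_unique:
  fixes g g' :: plane
  assumes "interior e \<noteq> {}" "\<And>x. x \<in> e \<Longrightarrow> inner g x + c = inner g' x + c'"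
  shows "g = g'"
proof -
  obtain x r where r: "0 < r" "cball x r \<subseteq> e"
    using assms(1) by (metis all_not_in_conv mem_interior_cball)
  \<comment> \<open>A displacement along \<open>g - g'\<close> that stays inside the ball; the added
    1 covers the case \<open>g = g'\<close>.\<close>
  define y where "y = x + (r / (norm (g - g') + 1)) *\<^sub>R (g - g')"
  have "r * norm (g - g') \<le> r * (norm (g - g') + 1)" using r by simp
  then have "norm ((r / (norm (g - g') + 1)) *\<^sub>R (g - g')) \<le> r"
    using r by (simp add: pos_divide_le_eq add_nonneg_pos)
  then have "y \<in> e" "x \<in> e"
    using r by (auto simp: y_def dist_norm intro!: subsetD[OF r(2)])
  then have "inner (g - g') (y - x) = 0"
    using assms(2)[of x] assms(2)[of y] by (simp add: algebra_simps)
  then have "r / (norm (g - g') + 1) * inner (g - g') (g - g') = 0"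
    by (simp add: y_def)
  moreover have "norm (g - g') + 1 \<noteq> 0" using norm_ge_zero[of "g - g'"] by linarith
  ultimately show ?thesis using r by simp
qed

lemma elem_grad_eqI:
  assumes "interior e \<noteq> {}" "\<And>x. x \<in> e \<Longrightarrow> u x = inner g x + c"
  shows "elem_grad u e = g"
  unfolding elem_grad_def
proof (rule the_equality)
  show "\<exists>c. \<forall>x\<in>e. u x = inner g x + c" using assms by blast
  fix g' assume "\<exists>c. \<forall>x\<in>e. u x = inner g' x + c"
  then obtain c' where "\<forall>x\<in>e. u x = inner g' x + c'" by blast
  with assms(2) show "g' = g"
    by (intro affine_function_gradient_unique[OF assms(1), of _ c' _ c]) auto
qed

lemma grad_eqI:
  fixes u :: "plane \<Rightarrow> real"
  assumes "GDERIV u x :> g"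
  shows "grad u x = g"
  unfolding grad_def
proof (rule the_equality)
  fix g' assume "GDERIV u x :> g'"
  with assms have "(\<lambda>h. inner h g) = (\<lambda>h. inner h g')"
    unfolding gderiv_def by (rule has_derivative_unique)
  then have "inner (g - g') g = inner (g - g') g'" by (rule fun_cong)
  then have "inner (g - g') (g - g') = 0" by (simp add: inner_diff_right)
  then show "g' = g" by simp
qed (rule assms)

lemma gderiv_affine_on_interior:
  fixes u :: "plane \<Rightarrow> real"
  assumes "x \<in> interior e" "\<And>y. y \<in> e \<Longrightarrow> u y = inner g y + c"
  shows "GDERIV u x :> g"
  unfolding gderiv_def
proof (rule has_derivative_transform_within_open[OF _ open_interior assms(1)])
  show "((\<lambda>y. inner g y + c) has_derivative (\<lambda>h. inner h g)) (at x)"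
    by (auto intro!: derivative_eq_intros simp: inner_commute)
qed (use assms(2) interior_subset in fastforce)

text \<open>Dimension two enters here: the vectors orthogonal to \<open>n\<close> form a line,
  spanned by \<open>d\<close>. In coordinates, the determinant of \<open>d\<close> and
  \<open>y\<close> vanishes because both are orthogonal to \<open>n\<close>.\<close>

lemma planar_orthogonal_collinear:
  fixes d n y :: plane
  assumes "inner n d = 0" "inner n y = 0" "n \<noteq> 0" "d \<noteq> 0"
  shows "y = (inner y d / inner d d) *\<^sub>R d"
proof -
  define n1 n2 d1 d2 y1 y2 where "n1 = vec_nth n 1" and "n2 = vec_nth n 2" and "d1 = vec_nth d 1"
    and "d2 = vec_nth d 2" and "y1 = vec_nth y 1" and "y2 = vec_nth y 2"
  note defs = n1_def n2_def d1_def d2_def y1_def y2_def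
  have nd: "n1 * d1 + n2 * d2 = 0" and ny: "n1 * y1 + n2 * y2 = 0"
    using assms by (auto simp: inner_vec_def sum_2 defs)
  have n: "n1 \<noteq> 0 \<or> n2 \<noteq> 0" and d: "d1 \<noteq> 0 \<or> d2 \<noteq> 0"
    using assms(3,4) by (auto simp: Finite_Cartesian_Product.vec_eq_iff forall_2 defs)
  have "n1 * (d1 * y2 - d2 * y1) = (n1 * d1 + n2 * d2) * y2 - d2 * (n1 * y1 + n2 * y2)"
    "n2 * (d1 * y2 - d2 * y1) = d1 * (n1 * y1 + n2 * y2) - (n1 * d1 + n2 * d2) * y1"
    by (simp_all add: algebra_simps)
  then have "n1 * (d1 * y2 - d2 * y1) = 0" "n2 * (d1 * y2 - d2 * y1) = 0"
    unfolding nd ny by simp_all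
  with n have cross: "d1 * y2 = d2 * y1" by auto
  have pos: "d1 * d1 + d2 * d2 > 0"
    using d by (simp add: sum_squares_gt_zero_iff)
  have "y1 = (y1 * d1 + y2 * d2) / (d1 * d1 + d2 * d2) * d1"
    "y2 = (y1 * d1 + y2 * d2) / (d1 * d1 + d2 * d2) * d2"
  proof -
    have "y1 * (d1 * d1 + d2 * d2) = y1 * d1 * d1 + d2 * (d2 * y1)"
      "y2 * (d1 * d1 + d2 * d2) = d1 * (d1 * y2) + y2 * d2 * d2"
      by (simp_all add: algebra_simps)
    then have "y1 * (d1 * d1 + d2 * d2) = (y1 * d1 + y2 * d2) * d1"
      "y2 * (d1 * d1 + d2 * d2) = (y1 * d1 + y2 * d2) * d2"
      using cross by (simp_all add: algebra_simps)
    then show "y1 = (y1 * d1 + y2 * d2) / (d1 * d1 + d2 * d2) * d1"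
      "y2 = (y1 * d1 + y2 * d2) / (d1 * d1 + d2 * d2) * d2"
      unfolding times_divide_eq_left using pos by (auto intro: eq_divide_imp)
  qed
  then show ?thesis
    by (simp add: Finite_Cartesian_Product.vec_eq_iff forall_2 inner_vec_def sum_2 flip: defs)
qed

text \<open>The ray from the midpoint of the edge in the direction of the normal does not depend on
  the third vertex \<open>c\<close>. Any two triangles on the same side of the edge therefore share
  its initial points, and \<open>U\<close> shows these to be interior points.\<close>

lemma half_neighbourhood_of_midpoint:
  fixes a b c n :: plane
  assumes ab: "a \<noteq> b" and n: "inner n (b - a) = 0" and c: "0 < inner n (c - a)"
  obtains U where "open U" "U \<subseteq> convex hull {a, b, c}"
    "eventually (\<lambda>t. midpoint a b + t *\<^sub>R n \<in> U) (at_right 0)"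
proof -
  define d where "d = b - a"
  \<comment> \<open>Barycentric coordinates: \<open>\<beta>\<close> belongs to \<open>c\<close> and
    is the relative height above the line through \<open>a\<close> and \<open>b\<close>;
    \<open>\<alpha>\<close> belongs to \<open>b\<close> and measures what is left along
    \<open>d\<close>. At the midpoint they are 0 and 1/2, so only the sign of \<open>\<beta>\<close>
    is not settled by continuity.\<close>
  define \<beta> where "\<beta> = (\<lambda>x. inner n (x - a) / inner n (c - a))"
  define \<alpha> where "\<alpha> = (\<lambda>x. inner (x - a - \<beta> x *\<^sub>R (c - a)) d / inner d d)"
  define U where "U = {x. 0 < \<beta> x} \<inter> {x. 0 < \<alpha> x} \<inter> {x. \<alpha> x + \<beta> x < 1}"
  have d: "d \<noteq> 0" "inner d d \<noteq> 0" using ab by (auto simp: d_def)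
  have n0: "n \<noteq> 0" using c by auto
  have cont: "continuous_on UNIV \<alpha>" "continuous_on UNIV \<beta>"
    unfolding \<alpha>_def \<beta>_def using d c by (auto intro!: continuous_intros)
  have "open U" unfolding U_def
    by (intro open_Int open_Collect_less cont continuous_intros)
  moreover have "U \<subseteq> convex hull {a, b, c}"
  proof
    fix x assume "x \<in> U"
    then have x: "0 < \<beta> x" "0 < \<alpha> x" "\<alpha> x + \<beta> x < 1" by (auto simp: U_def)
    have "inner n (x - a - \<beta> x *\<^sub>R (c - a)) = 0"
      using c by (simp add: \<beta>_def inner_diff_right)
    then have "x - a - \<beta> x *\<^sub>R (c - a) = \<alpha> x *\<^sub>R d"
      unfolding \<alpha>_def using n n0 d by (intro planar_orthogonal_collinear) (auto simp: d_def)
    then have "x = (1 - \<alpha> x - \<beta> x) *\<^sub>R a + \<alpha> x *\<^sub>R b + \<beta> x *\<^sub>R c"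
      by (simp add: d_def algebra_simps)
    moreover have "0 \<le> 1 - \<alpha> x - \<beta> x" "0 \<le> \<alpha> x" "0 \<le> \<beta> x" "1 - \<alpha> x - \<beta> x + \<alpha> x + \<beta> x = 1"
      using x by auto
    ultimately show "x \<in> convex hull {a, b, c}"
      unfolding convex_hull_3 by blast
  qed
  moreover have "eventually (\<lambda>t. midpoint a b + t *\<^sub>R n \<in> U) (at_right 0)"
  proof -
    define m where "m = (\<lambda>t::real. midpoint a b + t *\<^sub>R n)"
    have m0: "m 0 - a = (1/2) *\<^sub>R d"
      by (simp add: m_def d_def midpoint_def Finite_Cartesian_Product.vec_eq_iff field_simps)
    have \<beta>0: "\<beta> (m 0) = 0" using n by (simp add: \<beta>_def m0 flip: d_def)
    then have \<alpha>0: "\<alpha> (m 0) = 1/2" using d by (simp add: \<alpha>_def m0)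
    have cm: "continuous (at_right 0) m" unfolding m_def by (intro continuous_intros)
    have lim: "((\<lambda>t. f (m t)) \<longlongrightarrow> f (m 0)) (at_right 0)" if "continuous_on UNIV f" for f :: "plane \<Rightarrow> real"
    proof -
      have "isCont f (m 0)" using that continuous_on_eq_continuous_at[OF open_UNIV] by blast
      moreover have "(m \<longlongrightarrow> m 0) (at_right 0)" using cm by (simp add: continuous_within)
      ultimately show ?thesis by (rule isCont_tendsto_compose)
    qed
    have e1: "eventually (\<lambda>t. 0 < \<alpha> (m t)) (at_right 0)"
      using order_tendstoD(1)[OF lim[OF cont(1)], of 0] \<alpha>0 by simp
    have "((\<lambda>t. \<alpha> (m t) + \<beta> (m t)) \<longlongrightarrow> 1/2) (at_right 0)"
      using tendsto_add[OF lim[OF cont(1)] lim[OF cont(2)]] \<alpha>0 \<beta>0 by simp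
    then have e2: "eventually (\<lambda>t. \<alpha> (m t) + \<beta> (m t) < 1) (at_right 0)"
      by (rule order_tendstoD) simp
    have "0 < \<beta> (m t)" if "0 < t" for t
    proof -
      have "m t - a = (1/2) *\<^sub>R d + t *\<^sub>R n" using m0 by (simp add: m_def add_diff_eq[symmetric] diff_add_eq)
      then have "inner n (m t - a) = t * inner n n"
        using n by (simp add: inner_add_right flip: d_def)
      with that n0 c show ?thesis by (simp add: \<beta>_def)
    qed
    then have e3: "eventually (\<lambda>t. 0 < \<beta> (m t)) (at_right 0)"
      by (auto simp: eventually_at_right_less intro: eventually_mono[OF eventually_at_right_less])
    from e1 e2 e3 show ?thesis
      by eventually_elim (auto simp: U_def m_def)
  qed
  ultimately show ?thesis using that by blast
qed

lemma triangles_on_same_side_overlap: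
  fixes a b c c' n :: plane
  assumes ab: "a \<noteq> b" and n: "inner n (b - a) = 0"
    and e: "convex e" "{a, b, c} \<subseteq> e" "0 < inner n (c - a)"
    and e': "convex e'" "{a, b, c'} \<subseteq> e'" "0 < inner n (c' - a)"
  shows "interior e \<inter> interior e' \<noteq> {}"
proof -
  obtain U where U: "open U" "U \<subseteq> convex hull {a, b, c}"
    "eventually (\<lambda>t. midpoint a b + t *\<^sub>R n \<in> U) (at_right 0)"
    using half_neighbourhood_of_midpoint[OF ab n e(3)] by blast
  obtain U' where U': "open U'" "U' \<subseteq> convex hull {a, b, c'}"
    "eventually (\<lambda>t. midpoint a b + t *\<^sub>R n \<in> U') (at_right 0)"
    using half_neighbourhood_of_midpoint[OF ab n e'(3)] by blast
  have "eventually (\<lambda>t. midpoint a b + t *\<^sub>R n \<in> U \<inter> U') (at_right 0)"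
    using U(3) U'(3) by eventually_elim simp
  then obtain t where t: "midpoint a b + t *\<^sub>R n \<in> U \<inter> U'"
    using eventually_happens' trivial_limit_at_right_real by blast
  have "U \<subseteq> e" "U' \<subseteq> e'"
    using U(2) U'(2) hull_minimal[OF e(2), of convex] hull_minimal[OF e'(2), of convex] e e' by auto
  then have "U \<inter> U' \<subseteq> interior e \<inter> interior e'"
    using U(1) U'(1) interior_maximal by blast
  with t show ?thesis by blast
qed

lemma point_off_line:
  fixes a n :: plane
  assumes "interior e \<noteq> {}" "n \<noteq> 0"
  obtains c where "c \<in> e" "inner n (c - a) \<noteq> 0"
proof (rule ccontr)
  assume "\<not> thesis"
  with that have *: "inner n (c - a) = 0" if "c \<in> e" for c using that by blast
  have "n = 0"
    by (rule affine_function_gradient_unique[OF assms(1), of _ 0 _ "inner n a"])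
      (use * in \<open>simp add: inner_diff_right\<close>)
  with assms show False by simp
qed

section \<open>Conforming triangulations and piecewise affine functions\<close>

locale mesh =
  fixes \<Omega> :: "plane set" and \<T> :: "plane set set"
  assumes dom: "polygonal_domain \<Omega>" and tri: "triangulation_of \<Omega> \<T>"
begin

lemma domain_open: "open \<Omega>" and domain_bounded: "bounded \<Omega>"
  and interior_closure_domain: "interior (closure \<Omega>) = \<Omega>"
  using dom unfolding polygonal_domain_def by blast+

lemma finite_elements: "finite \<T>"
  and element_simplex: "e \<in> \<T> \<Longrightarrow> 2 simplex e"
  and element_Int_face: "e \<in> \<T> \<Longrightarrow> e' \<in> \<T> \<Longrightarrow> e \<inter> e' face_of e"
  and elements_cover: "\<Union>\<T> = closure \<Omega>"
  using tri unfolding triangulation_of_def triangulation_def by blast+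

lemma element_convex: "e \<in> \<T> \<Longrightarrow> convex e"
  and element_compact: "e \<in> \<T> \<Longrightarrow> compact e"
  and element_closed: "e \<in> \<T> \<Longrightarrow> closed e"
  using element_simplex convex_simplex compact_simplex closed_simplex by blast+

lemma element_interior_nonempty: "e \<in> \<T> \<Longrightarrow> interior e \<noteq> {}"
  and element_area_pos: "e \<in> \<T> \<Longrightarrow> 0 < area e"
  using element_simplex two_simplex_interior two_simplex_measure_pos by blast+

text \<open>This is where \<open>\<Omega>\<close> being the interior of its closure matters: the
  elements cover the closure, and without slits or punctures their interiors cannot leave
  \<open>\<Omega>\<close>.\<close>

lemma element_interior_subset: "e \<in> \<T> \<Longrightarrow> interior e \<subseteq> \<Omega>"
  using elements_cover interior_closure_domain interior_mono[of e "closure \<Omega>"] by blast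

text \<open>By conformity the intersection is a face of both elements. A proper face misses the
  interior, so the intersection is all of each.\<close>

lemma element_eqI:
  assumes "e \<in> \<T>" "e' \<in> \<T>" "interior e \<inter> interior e' \<noteq> {}"
  shows "e = e'"
proof -
  have "e \<inter> e' = e" if "e \<in> \<T>" "e' \<in> \<T>" "interior e \<inter> interior e' \<noteq> {}" for e e'
    using that face_of_disjoint_interior[OF element_Int_face[OF that(1,2)]] interior_subset by blast
  from this[of e e'] this[of e' e] assms show ?thesis by blast
qed

text \<open>Pigeonhole: of three elements containing a segment, two have points on the same side of
  its line, and these two overlap. This gives both the uniqueness of neighbours and the bound on how
  often an element serves as a neighbour.\<close>

lemma segment_shared_by_at_most_two:
  assumes e: "e \<in> \<T>" "e\<^sub>1 \<in> \<T>" "e\<^sub>2 \<in> \<T>" and ne: "e\<^sub>1 \<noteq> e" "e\<^sub>2 \<noteq> e"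
    and ab: "a \<noteq> b" "{a, b} \<subseteq> e" "{a, b} \<subseteq> e\<^sub>1" "{a, b} \<subseteq> e\<^sub>2"
  shows "e\<^sub>1 = e\<^sub>2"
proof -
  \<comment> \<open>The direction \<open>b - a\<close> turned by a right angle.\<close>
  define n :: plane where "n = vector [- vec_nth (b - a) 2, vec_nth (b - a) 1]"
  have n: "n \<noteq> 0" "inner n (b - a) = 0"
    using ab(1) by (auto simp: n_def Finite_Cartesian_Product.vec_eq_iff forall_2 inner_vec_def sum_2 algebra_simps)
  have n': "inner (- n) (b - a) = 0" using n by simp
  obtain c c\<^sub>1 c\<^sub>2 where c: "c \<in> e" "inner n (c - a) \<noteq> 0" "c\<^sub>1 \<in> e\<^sub>1" "inner n (c\<^sub>1 - a) \<noteq> 0"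
    "c\<^sub>2 \<in> e\<^sub>2" "inner n (c\<^sub>2 - a) \<noteq> 0"
    using point_off_line[OF element_interior_nonempty n(1)] e by metis
  have same: "f = f'" if "f \<in> \<T>" "f' \<in> \<T>" "{a, b} \<subseteq> f" "{a, b} \<subseteq> f'" "x \<in> f" "y \<in> f'"
    "0 < inner n (x - a) \<and> 0 < inner n (y - a) \<or> inner n (x - a) < 0 \<and> inner n (y - a) < 0" for f f' x y
    using that(7)
  proof
    assume "0 < inner n (x - a) \<and> 0 < inner n (y - a)"
    with that triangles_on_same_side_overlap[OF ab(1) n(2), of f x f' y] element_convex
    show ?thesis by (intro element_eqI) auto
  next
    assume "inner n (x - a) < 0 \<and> inner n (y - a) < 0"
    with that triangles_on_same_side_overlap[OF ab(1) n', of f x f' y] element_convex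
    show ?thesis by (intro element_eqI) auto
  qed
  show ?thesis
    using same[of e e\<^sub>1 c c\<^sub>1] same[of e e\<^sub>2 c c\<^sub>2] same[of e\<^sub>1 e\<^sub>2 c\<^sub>1 c\<^sub>2] e ne ab c
    by (metis linorder_neqE_linordered_idom)
qed

text \<open>The representation is required on closed elements, so two of them agree wherever
  elements meet; this encodes continuity without a separate condition.\<close>

definition piecewise_affine :: "(plane \<Rightarrow> real) \<Rightarrow> bool" where
  "piecewise_affine u \<longleftrightarrow> (\<forall>e\<in>\<T>. \<exists>g c. \<forall>x\<in>e. u x = inner g x + c)"

lemma piecewise_affineE:
  assumes "piecewise_affine u" "e \<in> \<T>"
  obtains c where "\<And>x. x \<in> e \<Longrightarrow> u x = inner (elem_grad u e) x + c"
proof -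
  obtain g c where gc: "\<And>x. x \<in> e \<Longrightarrow> u x = inner g x + c"
    using assms unfolding piecewise_affine_def by blast
  with elem_grad_eqI[OF element_interior_nonempty[OF assms(2)] gc] that show ?thesis by blast
qed

lemma elem_grad_diff:
  assumes "piecewise_affine u" "e \<in> \<T>" "x \<in> e" "y \<in> e"
  shows "inner (elem_grad u e) (x - y) = u x - u y"
proof -
  obtain c where "\<And>x. x \<in> e \<Longrightarrow> u x = inner (elem_grad u e) x + c"
    using piecewise_affineE[OF assms(1,2)] by metis
  with assms(3,4) show ?thesis by (simp add: inner_diff_right)
qed

lemma grad_eq_elem_grad:
  assumes "piecewise_affine u" "e \<in> \<T>" "x \<in> interior e"
  shows "grad u x = elem_grad u e"
proof -
  obtain c where "\<And>x. x \<in> e \<Longrightarrow> u x = inner (elem_grad u e) x + c"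
    using piecewise_affineE[OF assms(1,2)] by metis
  with assms(3) show ?thesis by (intro grad_eqI gderiv_affine_on_interior)
qed

lemma AE_interior_element: "AE x in lebesgue. x \<in> \<Omega> \<longrightarrow> (\<exists>e\<in>\<T>. x \<in> interior e)"
proof -
  have "negligible (\<Union>e\<in>\<T>. frontier e)"
    using finite_elements element_convex by (intro negligible_Union) (auto intro: negligible_convex_frontier)
  then have "AE x in lebesgue. x \<notin> (\<Union>e\<in>\<T>. frontier e)"
    unfolding negligible_iff_null_sets by (rule AE_not_in)
  then show ?thesis
  proof eventually_elim
    case (elim x)
    show ?case
    proof
      assume "x \<in> \<Omega>"
      then obtain e where "e \<in> \<T>" "x \<in> e"
        using elements_cover closure_subset[of \<Omega>] by (metis UnionE subsetD)
      with elim show "\<exists>e\<in>\<T>. x \<in> interior e"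
        using closure_subset[of e] unfolding frontier_def by blast
    qed
  qed
qed

lemma sum_indicator_interior:
  fixes w :: "plane set \<Rightarrow> 'a::real_vector"
  assumes "e \<in> \<T>" "x \<in> interior e"
  shows "(\<Sum>e'\<in>\<T>. indicator (interior e') x *\<^sub>R w e') = w e"
proof -
  have "indicator (interior e') x *\<^sub>R w e' = (if e' = e then w e else 0)" if "e' \<in> \<T>" for e'
  proof (cases "e' = e")
    case False
    then have "x \<notin> interior e'" using element_eqI[OF assms(1) that] assms(2) by blast
    with False show ?thesis by simp
  qed (use assms(2) in simp)
  then show ?thesis using assms finite_elements by simp
qed

lemma area_eq_interior: "e \<in> \<T> \<Longrightarrow> area e = measure lebesgue (interior e)"
  unfolding area_def
  using measure_interior[of e] element_compact[of e] element_convex[of e]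
  by (simp add: compact_imp_bounded negligible_convex_frontier)

text \<open>Once the integral is a finite sum over elements, comparing it with the smoothed form is
  pure algebra.\<close>

lemma fem_form_self:
  assumes u: "piecewise_affine u"
  shows "fem_form \<Omega> u u = (\<Sum>e\<in>\<T>. area e * (norm (elem_grad u e))\<^sup>2)"
proof -
  \<comment> \<open>A step function replaces the squared gradient, because \<open>grad\<close> is an
    arbitrary value at points on edges where the derivative fails to exist.\<close>
  define G where "G = (\<lambda>x. \<Sum>e\<in>\<T>. indicator (interior e) x *\<^sub>R (norm (elem_grad u e))\<^sup>2)"
  have lm: "interior e \<in> lmeasurable" if "e \<in> \<T>" for e
    using element_compact[OF that] by (simp add: compact_imp_bounded lmeasurable_interior)
  have G_meas: "G \<in> borel_measurable lebesgue"
    unfolding G_def using lm by (intro borel_measurable_sum borel_measurable_scaleR borel_measurable_indicator) auto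
  have AE: "AE x in lebesgue. G x = indicator \<Omega> x *\<^sub>R inner (grad u x) (grad u x)"
    using AE_interior_element
  proof eventually_elim
    case (elim x)
    show ?case
    proof (cases "x \<in> \<Omega>")
      case True
      then obtain e where "e \<in> \<T>" "x \<in> interior e" using elim by blast
      with True show ?thesis
        unfolding G_def sum_indicator_interior[OF \<open>e \<in> \<T>\<close> \<open>x \<in> interior e\<close>]
        by (simp add: grad_eq_elem_grad[OF u] power2_norm_eq_inner)
    next
      case False
      then have "indicator (interior e) x *\<^sub>R (norm (elem_grad u e))\<^sup>2 = 0" if "e \<in> \<T>" for e
        using element_interior_subset[OF that] by (auto simp: indicator_def)
      then have "G x = 0" unfolding G_def by (intro sum.neutral) blast
      with False show ?thesis by simp
    qed
  qed
  have "fem_form \<Omega> u u = (LINT x|lebesgue. indicator \<Omega> x *\<^sub>R inner (grad u x) (grad u x))"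
    unfolding fem_form_def using domain_open by (intro integral_restrict_space) auto
  also have "\<dots> = (LINT x|lebesgue. G x)"
    using AE G_meas borel_measurable_AE[OF G_meas AE] by (intro integral_cong_AE) auto
  also have "\<dots> = (\<Sum>e\<in>\<T>. LINT x|lebesgue. indicator (interior e) x *\<^sub>R (norm (elem_grad u e))\<^sup>2)"
    unfolding G_def using lm by (intro Bochner_Integration.integral_sum) (auto simp: fmeasurable_def)
  also have "\<dots> = (\<Sum>e\<in>\<T>. area e * (norm (elem_grad u e))\<^sup>2)"
    by (intro sum.cong) (auto simp: area_eq_interior)
  finally show ?thesis .
qed

end

section \<open>Comparison of the two bilinear forms\<close>

text \<open>Moving one point to the origin turns affine independence into linear independence, where
  a linear map may be prescribed freely.\<close>

lemma affine_interpolation: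
  fixes C :: "'a::euclidean_space set" and f :: "'a \<Rightarrow> 'b::euclidean_space"
  assumes "\<not> affine_dependent C"
  obtains A c where "linear A" "\<And>x. x \<in> C \<Longrightarrow> A x + c = f x"
proof (cases "C = {}")
  case True
  then show ?thesis using that[OF linear_zero] by simp
next
  case False
  then obtain a where a: "a \<in> C" by blast
  define S where "S = C - {a}"
  have C: "C = insert a S" "a \<notin> S" using a by (auto simp: S_def)
  have "independent ((\<lambda>x. - a + x) ` S)"
    using assms affine_dependent_iff_dependent[OF C(2)] C by simp
  then obtain A where A: "linear A" "\<forall>y\<in>(\<lambda>x. - a + x) ` S. A y = f (y + a) - f a"
    using linear_independent_extend[where f = "\<lambda>y. f (y + a) - f a"] by blast
  show ?thesis
  proof (rule that[OF A(1)])
    fix x assume "x \<in> C"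
    have "A (- a + x) = f x - f a"
    proof (cases "x = a")
      case True
      then show ?thesis using linear_0[OF A(1)] by simp
    next
      case False
      with \<open>x \<in> C\<close> have "x \<in> S" by (simp add: S_def)
      with A(2) show ?thesis by simp
    qed
    then show "A x + (f a - A a) = f x"
      using linear_diff[OF A(1), of x a] by (simp add: algebra_simps)
  qed
qed

lemma affine_interpolation_real:
  fixes C :: "'a::euclidean_space set" and f :: "'a \<Rightarrow> real"
  assumes "\<not> affine_dependent C"
  obtains g c where "\<And>x. x \<in> C \<Longrightarrow> f x = inner g x + c"
proof -
  obtain A c where A: "linear A" "\<And>x. x \<in> C \<Longrightarrow> A x + c = f x"
    using affine_interpolation[OF assms, where f = f] by metis
  have "A x = inner (adjoint A 1) x" for x
    using adjoint_works[OF A(1), of x 1] by (simp add: inner_commute)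
  with A(2) that show ?thesis by metis
qed

lemma affine_maps_eqI:
  fixes A A' :: "'a::euclidean_space \<Rightarrow> 'b::euclidean_space"
  assumes "linear A" "linear A'" "affine hull C = UNIV" "\<And>x. x \<in> C \<Longrightarrow> A x + c = A' x + c'"
  shows "A x + c = A' x + c'"
proof -
  have "affine {x. A x + c = A' x + c'}"
    unfolding affine_def
  proof clarify
    fix x y and u v :: real
    assume xy: "A x + c = A' x + c'" "A y + c = A' y + c'" and uv: "u + v = 1"
    have aff: "L (u *\<^sub>R x + v *\<^sub>R y) + d = u *\<^sub>R (L x + d) + v *\<^sub>R (L y + d)"
      if "linear L" for L :: "'a \<Rightarrow> 'b" and d
      using uv by (simp add: linear_add[OF that] linear_scale[OF that] scaleR_add_right)
        (metis scaleR_add_left scaleR_one)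
    show "A (u *\<^sub>R x + v *\<^sub>R y) + c = A' (u *\<^sub>R x + v *\<^sub>R y) + c'"
      unfolding aff[OF assms(1)] aff[OF assms(2)] xy ..
  qed
  then have "affine hull C \<subseteq> {x. A x + c = A' x + c'}"
    using assms(4) by (intro hull_minimal) auto
  with assms(3) show ?thesis by blast
qed

abbreviation next_vertex :: "nat \<Rightarrow> nat" where
  "next_vertex k \<equiv> (if k = 3 then 1 else k + 1)"

abbreviation prev_vertex :: "nat \<Rightarrow> nat" where
  "prev_vertex k \<equiv> (if k = 1 then 3 else k - 1)"

text \<open>In the direction of \<open>g\<close> a triangle is at least as wide as any disc inside
  it. A linear functional attains its extremes over the triangle at vertices, and any two distinct
  vertices are joined by an edge.\<close>

lemma triangle_width:
  fixes g x :: plane and P :: "nat \<Rightarrow> plane"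
  assumes cball: "cball x r \<subseteq> convex hull (P ` {1..3})" and "0 \<le> r"
  obtains k where "k \<in> {1..3}" "2 * r * norm g \<le> \<bar>inner g (P (next_vertex k) - P k)\<bar>"
proof -
  define y where "y = r *\<^sub>R sgn g"
  have "norm y \<le> r" using assms(2) by (simp add: y_def norm_sgn)
  then have mem: "x + y \<in> convex hull (P ` {1..3})" "x - y \<in> convex hull (P ` {1..3})"
    using cball by (auto simp: dist_norm intro!: subsetD[OF cball])
  have gy: "inner g y = r * norm g"
    by (cases "g = 0")
      (simp_all add: y_def sgn_div_norm power2_norm_eq_inner[symmetric] power2_eq_square)
  have max: "\<exists>i\<in>{1..3}. inner h z \<le> inner h (P i)" if z: "z \<in> convex hull (P ` {1..3})" for h z
  proof -
    define M where "M = Max ((\<lambda>i. inner h (P i)) ` {1..3})"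
    have "P ` {1..3} \<subseteq> {w. inner h w \<le> M}" by (auto simp: M_def intro!: Max_ge)
    then have "convex hull (P ` {1..3}) \<subseteq> {w. inner h w \<le> M}"
      by (intro hull_minimal convex_halfspace_le)
    moreover have "M \<in> (\<lambda>i. inner h (P i)) ` {1..3}" unfolding M_def by (intro Max_in) auto
    ultimately show ?thesis using z by blast
  qed
  obtain i where i: "i \<in> {1..3}" "inner g (x + y) \<le> inner g (P i)" using max[OF mem(1)] by blast
  obtain j where j: "j \<in> {1..3}" "inner (- g) (x - y) \<le> inner (- g) (P j)"
    using max[OF mem(2)] by blast
  have ij: "2 * r * norm g \<le> inner g (P i - P j)"
    using i(2) j(2) gy by (simp add: inner_add_right inner_diff_right)
  have "i = 1 \<or> i = 2 \<or> i = 3" "j = 1 \<or> j = 2 \<or> j = 3" using i(1) j(1) by auto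
  \<comment> \<open>With three indices, distinct ones are always cyclic neighbours. For
    \<open>i = j\<close> the left-hand side of \<open>ij\<close> is at most 0 and any edge will
    do.\<close>
  then consider "i = j" | "i = next_vertex j" | "j = next_vertex i" by auto
  then show ?thesis
  proof cases
    case 1
    then have "2 * r * norm g \<le> \<bar>inner g (P (next_vertex i) - P i)\<bar>" using ij by simp
    with that i(1) show ?thesis by blast
  next
    case 2
    with ij have "2 * r * norm g \<le> \<bar>inner g (P (next_vertex j) - P j)\<bar>" by simp
    with that j(1) show ?thesis by blast
  next
    case 3
    with ij have "2 * r * norm g \<le> \<bar>inner g (P (next_vertex i) - P i)\<bar>"
      by (simp add: inner_diff_right)
    with that i(1) show ?thesis by blast
  qed
qed

text \<open>Convexity of the squared norm, with the defect
  \<open>a * b * (norm (g - g'))\<^sup>2\<close> made explicit. Since the mean is weighted by area,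
  the factor \<open>a\<close> on the left leaves no quotient of \<open>a\<close> and
  \<open>b\<close> on the right.\<close>

lemma norm_weighted_mean_le:
  fixes g g' :: "'a::real_inner"
  assumes "0 < a" "0 < b"
  shows "a * (norm ((1 / (a + b)) *\<^sub>R (a *\<^sub>R g + b *\<^sub>R g')))\<^sup>2 \<le> a * (norm g)\<^sup>2 + b * (norm g')\<^sup>2"
proof -
  have "(norm (a *\<^sub>R g + b *\<^sub>R g'))\<^sup>2 + a * b * (norm (g - g'))\<^sup>2
      = (a + b) * (a * (norm g)\<^sup>2 + b * (norm g')\<^sup>2)"
    unfolding power2_norm_eq_inner
    by (simp add: inner_add_left inner_add_right inner_diff_left inner_diff_right inner_commute
        algebra_simps)
  moreover have "0 \<le> a * b * (norm (g - g'))\<^sup>2" using assms by simp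
  ultimately have le: "(norm (a *\<^sub>R g + b *\<^sub>R g'))\<^sup>2 \<le> (a + b) * (a * (norm g)\<^sup>2 + b * (norm g')\<^sup>2)"
    by linarith
  have nn: "0 \<le> a * (norm g)\<^sup>2 + b * (norm g')\<^sup>2" using assms by simp
  have "a * (norm ((1 / (a + b)) *\<^sub>R (a *\<^sub>R g + b *\<^sub>R g')))\<^sup>2
      = a / (a + b)\<^sup>2 * (norm (a *\<^sub>R g + b *\<^sub>R g'))\<^sup>2"
    using assms by (simp add: power_divide)
  also have "\<dots> \<le> a / (a + b)\<^sup>2 * ((a + b) * (a * (norm g)\<^sup>2 + b * (norm g')\<^sup>2))"
    using le assms by (intro mult_left_mono) auto
  also have "\<dots> = a / (a + b) * (a * (norm g)\<^sup>2 + b * (norm g')\<^sup>2)"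
    using assms by (simp add: power2_eq_square)
  also have "\<dots> \<le> 1 * (a * (norm g)\<^sup>2 + b * (norm g')\<^sup>2)"
    using assms nn by (intro mult_right_mono) auto
  finally show ?thesis by simp
qed

lemma norm_half_sum_le:
  fixes x y :: "'a::real_inner"
  shows "(norm ((1/2) *\<^sub>R (x + y)))\<^sup>2 \<le> ((norm x)\<^sup>2 + (norm y)\<^sup>2) / 2"
proof -
  have "(norm ((1/2) *\<^sub>R (x + y)))\<^sup>2 + (norm (x - y))\<^sup>2 / 4 = ((norm x)\<^sup>2 + (norm y)\<^sup>2) / 2"
    unfolding power2_norm_eq_inner
    by (simp add: inner_add_left inner_add_right inner_diff_left inner_diff_right inner_commute field_simps)
  moreover have "0 \<le> (norm (x - y))\<^sup>2 / 4" by simp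
  ultimately show ?thesis by linarith
qed

lemma norm_sum3_le:
  fixes x y z :: "'a::real_normed_vector"
  shows "(norm (x + y - z))\<^sup>2 \<le> 3 * ((norm x)\<^sup>2 + (norm y)\<^sup>2 + (norm z)\<^sup>2)"
proof -
  have "norm (x + y - z) \<le> norm x + norm y + norm z"
    using norm_triangle_ineq[of x y] norm_triangle_ineq4[of "x + y" z] by linarith
  then have "(norm (x + y - z))\<^sup>2 \<le> (norm x + norm y + norm z)\<^sup>2"
    by (intro power_mono) auto
  also have "\<dots> + ((norm x - norm y)\<^sup>2 + (norm y - norm z)\<^sup>2 + (norm z - norm x)\<^sup>2)
      = 3 * ((norm x)\<^sup>2 + (norm y)\<^sup>2 + (norm z)\<^sup>2)"
    by (simp add: power2_eq_square algebra_simps)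
  finally show ?thesis
    using zero_le_power2[of "norm x - norm y"] zero_le_power2[of "norm y - norm z"]
      zero_le_power2[of "norm z - norm x"] by linarith
qed

lemma sum_1_3: "(\<Sum>k = 1..3. f k) = f 1 + f 2 + f (3::nat)" for f :: "nat \<Rightarrow> 'a::comm_monoid_add"
proof -
  have "{1..3} = {1, 2, 3::nat}" by auto
  then show ?thesis by (simp add: add.assoc)
qed

text \<open>The number of vertices of a triangle is odd, so the edge values can be recovered from the
  averages of cyclically consecutive ones.\<close>

lemma edge_value_le_averages:
  fixes v :: "nat \<Rightarrow> 'a::real_inner"
  assumes "k \<in> {1..3}"
  shows "(norm (v k))\<^sup>2 \<le> 3 * (\<Sum>k = 1..3. (norm ((1/2) *\<^sub>R (v (prev_vertex k) + v k)))\<^sup>2)"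
proof -
  define a where "a k = (1/2) *\<^sub>R (v (prev_vertex k) + v k)" for k
  have half: "(1/2) *\<^sub>R x + (1/2) *\<^sub>R x = x" for x :: 'a
    by (simp flip: scaleR_add_left)
  \<comment> \<open>The inverse of cyclic averaging on three values: the two averages containing a
    value, minus the third one.\<close>
  have v: "v 1 = a 1 + a 2 - a 3" "v 2 = a 2 + a 3 - a 1" "v 3 = a 3 + a 1 - a 2"
    using half[of "v 1"] half[of "v 2"] half[of "v 3"]
    by (simp_all add: a_def scaleR_add_right algebra_simps)
  define S where "S = 3 * ((norm (a 1))\<^sup>2 + (norm (a 2))\<^sup>2 + (norm (a 3))\<^sup>2)"
  have "(norm (v 1))\<^sup>2 \<le> S"
    unfolding v S_def by (rule norm_sum3_le)
  moreover have "(norm (v 2))\<^sup>2 \<le> S"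
    unfolding v(2) using norm_sum3_le[of "a 2" "a 3" "a 1"] by (simp add: S_def ac_simps)
  moreover have "(norm (v 3))\<^sup>2 \<le> S"
    unfolding v(3) using norm_sum3_le[of "a 3" "a 1" "a 2"] by (simp add: S_def ac_simps)
  moreover have "k = 1 \<or> k = 2 \<or> k = 3" using assms by auto
  ultimately have "(norm (v k))\<^sup>2 \<le> S" by blast
  then show ?thesis unfolding S_def sum_1_3 a_def .
qed

text \<open>Each edge value enters exactly two of the averages, each time with weight one
  half.\<close>

lemma averages_le_edge_values:
  fixes v :: "nat \<Rightarrow> 'a::real_inner"
  shows "(\<Sum>k = 1..3. (norm ((1/2) *\<^sub>R (v (prev_vertex k) + v k)))\<^sup>2) \<le> (\<Sum>k = 1..3. (norm (v k))\<^sup>2)"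
proof -
  have prev: "prev_vertex 1 = 3" "prev_vertex 2 = 1" "prev_vertex 3 = 2" by simp_all
  have "(\<Sum>k = 1..3. (norm ((1/2) *\<^sub>R (v (prev_vertex k) + v k)))\<^sup>2)
      \<le> ((norm (v 3))\<^sup>2 + (norm (v 1))\<^sup>2) / 2 + ((norm (v 1))\<^sup>2 + (norm (v 2))\<^sup>2) / 2
        + ((norm (v 2))\<^sup>2 + (norm (v 3))\<^sup>2) / 2"
    unfolding sum_1_3 prev by (intro add_mono norm_half_sum_le)
  also have "\<dots> = (norm (v 1))\<^sup>2 + (norm (v 2))\<^sup>2 + (norm (v 3))\<^sup>2"
    by (simp add: field_simps)
  finally show ?thesis unfolding sum_1_3 .
qed

section \<open>Smoothed strains on a mesh with numbered vertices\<close>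

locale numbered_mesh = mesh +
  fixes p :: "plane set \<Rightarrow> nat \<Rightarrow> plane"
  assumes numbering: "vertex_numbering \<T> p"
begin

lemma vertices:
  assumes "e \<in> \<T>"
  shows "inj_on (p e) {1..3}" "p e ` {1..3} = {x. x extreme_point_of e}"
    "\<not> affine_dependent (p e ` {1..3})" "convex hull (p e ` {1..3}) = e"
    "affine hull (p e ` {1..3}) = UNIV"
proof -
  have bij: "bij_betw (p e) {1..3} {x. x extreme_point_of e}"
    using numbering assms unfolding vertex_numbering_def by blast
  show "inj_on (p e) {1..3}" "p e ` {1..3} = {x. x extreme_point_of e}"
    using bij unfolding bij_betw_def by blast+
  obtain C where C: "\<not> affine_dependent C" "e = convex hull C" "C = {x. x extreme_point_of e}"
    using two_simplex_vertices[OF element_simplex[OF assms]] by metis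
  have pC: "p e ` {1..3} = C" unfolding C(3) by (rule bij_betw_imp_surj_on[OF bij])
  show "\<not> affine_dependent (p e ` {1..3})" unfolding pC by (rule C(1))
  show hull: "convex hull (p e ` {1..3}) = e" unfolding pC by (rule C(2)[symmetric])
  have "affine hull C = affine hull e" using affine_hull_convex_hull[of C] C(2) by (simp only:)
  moreover have "affine hull e = UNIV"
    using element_interior_nonempty[OF assms] by (rule affine_hull_nonempty_interior)
  ultimately show "affine hull (p e ` {1..3}) = UNIV" unfolding pC by simp
qed

lemma vertex_in_element:
  assumes "e \<in> \<T>" "k \<in> {1..3}"
  shows "p e k \<in> e"
  using hull_inc[OF imageI[OF assms(2), of "p e"], of convex] vertices(4)[OF assms(1)] by simp

lemma edge_nondegenerate:
  assumes "e \<in> \<T>" "k \<in> {1..3}"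
  shows "p e k \<noteq> p e (next_vertex k)"
  using inj_onD[OF vertices(1)[OF assms(1)], of k "next_vertex k"] assms(2) by auto

lemma next_vertex_in: "k \<in> {1..3} \<Longrightarrow> next_vertex k \<in> {1..3}"
  by auto

lemma neighbor_contains_edge:
  assumes "is_neighbor \<T> p e k e'"
  shows "e' \<in> \<T>" "e' \<noteq> e" "p e k \<in> e'" "p e (next_vertex k) \<in> e'"
proof -
  have "e' \<in> \<T> \<and> e' \<noteq> e" and seg: "e \<inter> e' = closed_segment (p e k) (p e (next_vertex k))"
    using assms unfolding is_neighbor_def edge_def by blast+
  then show "e' \<in> \<T>" "e' \<noteq> e" by blast+
  show "p e k \<in> e'" "p e (next_vertex k) \<in> e'"
    using seg ends_in_segment[of "p e k" "p e (next_vertex k)"] by blast+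
qed

text \<open>This justifies the definite description in \<open>edge_strain\<close>.\<close>

lemma neighbor_unique:
  assumes e: "e \<in> \<T>" "k \<in> {1..3}" and "is_neighbor \<T> p e k e\<^sub>1" "is_neighbor \<T> p e k e\<^sub>2"
  shows "e\<^sub>1 = e\<^sub>2"
  using segment_shared_by_at_most_two[OF e(1), of e\<^sub>1 e\<^sub>2 "p e k" "p e (next_vertex k)"]
    edge_nondegenerate[OF e] vertex_in_element[OF e] vertex_in_element[OF e(1) next_vertex_in[OF e(2)]]
    neighbor_contains_edge[OF assms(3)] neighbor_contains_edge[OF assms(4)]
  by blast

lemma edge_strain_neighbor:
  assumes e: "e \<in> \<T>" "k \<in> {1..3}" and nb: "is_neighbor \<T> p e k e'"
  shows "edge_strain \<T> p u e k =
    (1 / (area e + area e')) *\<^sub>R (area e *\<^sub>R elem_grad u e + area e' *\<^sub>R elem_grad u e')"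
proof -
  have "(THE e'. is_neighbor \<T> p e k e') = e'"
    by (rule the_equality, rule nb, rule neighbor_unique[OF e _ nb])
  moreover have "\<exists>e'. is_neighbor \<T> p e k e'" using nb by blast
  ultimately show ?thesis unfolding edge_strain_def by (simp add: Let_def)
qed

lemma edge_strain_no_neighbor:
  assumes "\<And>e'. \<not> is_neighbor \<T> p e k e'"
  shows "edge_strain \<T> p u e k = elem_grad u e"
proof -
  have "\<not> (\<exists>e'. is_neighbor \<T> p e k e')" using assms by blast
  then show ?thesis unfolding edge_strain_def by (rule if_not_P)
qed

text \<open>The tangential derivative of \<open>u\<close> is continuous across edges, so averaging does not
  change it.\<close>

lemma edge_strain_tangential:
  assumes u: "piecewise_affine u" and e: "e \<in> \<T>" "k \<in> {1..3}"
  shows "inner (edge_strain \<T> p u e k) (p e (next_vertex k) - p e k)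
    = inner (elem_grad u e) (p e (next_vertex k) - p e k)"
proof (cases "\<exists>e'. is_neighbor \<T> p e k e'")
  case False
  then show ?thesis by (simp add: edge_strain_no_neighbor)
next
  case True
  then obtain e' where nb: "is_neighbor \<T> p e k e'" by blast
  note e' = neighbor_contains_edge[OF nb]
  define d where "d = p e (next_vertex k) - p e k"
  have *: "inner (elem_grad u e') d = inner (elem_grad u e) d"
    unfolding d_def
    using elem_grad_diff[OF u e'(1) e'(4,3)]
      elem_grad_diff[OF u e(1) vertex_in_element[OF e(1) next_vertex_in[OF e(2)]] vertex_in_element[OF e]]
    by simp
  have pos: "0 < area e + area e'" using element_area_pos[OF e(1)] element_area_pos[OF e'(1)] by simp
  have "inner (edge_strain \<T> p u e k) d = (area e + area e') / (area e + area e') * inner (elem_grad u e) d"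
    unfolding edge_strain_neighbor[OF e nb]
    by (simp only: inner_scaleR_left inner_add_left * distrib_right[symmetric] times_divide_eq_left
        mult_1_left times_divide_eq_right)
  then show ?thesis using pos unfolding d_def by simp
qed

text \<open>The sum has at most one term. Written as a sum, the bound covers boundary edges through
  the empty case and is ready for an exchange of summations.\<close>

lemma edge_strain_norm_le:
  assumes e: "e \<in> \<T>" "k \<in> {1..3}"
  shows "area e * (norm (edge_strain \<T> p u e k))\<^sup>2 \<le> area e * (norm (elem_grad u e))\<^sup>2
    + (\<Sum>e' | is_neighbor \<T> p e k e'. area e' * (norm (elem_grad u e'))\<^sup>2)"
proof (cases "\<exists>e'. is_neighbor \<T> p e k e'")
  case False
  then show ?thesis by (simp add: edge_strain_no_neighbor)
next
  case True
  then obtain e' where nb: "is_neighbor \<T> p e k e'" by blast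
  then have "{e'. is_neighbor \<T> p e k e'} = {e'}" using neighbor_unique[OF e _ nb] by blast
  then show ?thesis
    using norm_weighted_mean_le[of "area e" "area e'" "elem_grad u e" "elem_grad u e'"]
      element_area_pos[OF e(1)] element_area_pos[OF neighbor_contains_edge(1)[OF nb]]
    by (simp add: edge_strain_neighbor[OF e nb])
qed

text \<open>The Gauss points are the images of the vertices under the homothety with ratio 1/2 about
  the centroid. Hence they determine an affine map exactly as the vertices do, and the definite
  description in \<open>sse_gradient\<close> is justified.\<close>

lemma sse_gradient_gauss_point:
  assumes e: "e \<in> \<T>" and k: "k \<in> {1..3}"
  shows "sse_gradient \<T> p u e (gauss_point p e k)
    = (1/2) *\<^sub>R (edge_strain \<T> p u e (prev_vertex k) + edge_strain \<T> p u e k)"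
proof -
  define v where "v k = (1/2) *\<^sub>R (edge_strain \<T> p u e (prev_vertex k) + edge_strain \<T> p u e k)" for k
  define s where "s = (1/6) *\<^sub>R (\<Sum>j = 1..3. p e j)"
  have G: "gauss_point p e k = (1/2) *\<^sub>R p e k + s" for k by (simp add: gauss_point_def s_def)
  define P where "P = (\<lambda>q. (\<exists>A c. linear A \<and> q = (\<lambda>x. A x + c)) \<and>
    (\<forall>k\<in>{1..3}. q (gauss_point p e k) = v k))"
  have "\<exists>!q. P q"
  proof (rule ex_ex1I)
    obtain A c where A: "linear A" "\<And>x. x \<in> p e ` {1..3} \<Longrightarrow> A x + c = v (inv_into {1..3} (p e) x)"
      using affine_interpolation[OF vertices(3)[OF e], where f = "\<lambda>x. v (inv_into {1..3} (p e) x)"] by metis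
    have Av: "A (p e k) + c = v k" if "k \<in> {1..3}" for k
      using A(2)[OF imageI[OF that]] unfolding inv_into_f_f[OF vertices(1)[OF e] that] .
    \<comment> \<open>The interpolant at the vertices composed with the inverse homothety, which
      sends \<open>x\<close> to \<open>2 *\<^sub>R (x - s)\<close>.\<close>
    define q where "q = (\<lambda>x. 2 *\<^sub>R A x + (c - 2 *\<^sub>R A s))"
    have "linear (\<lambda>x. 2 *\<^sub>R A x)" using A(1) by (intro linear_compose_scale_right)
    moreover have "q (gauss_point p e k) = v k" if "k \<in> {1..3}" for k
      using Av[OF that] by (simp add: q_def G linear_add[OF A(1)] linear_scale[OF A(1)] scaleR_add_right)
    ultimately have "P q" unfolding P_def q_def by blast
    then show "\<exists>q. P q" by (rule exI[of P q])
  next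
    fix q q' assume "P q" "P q'"
    then obtain A c A' c' where A: "linear A" "q = (\<lambda>x. A x + c)" "linear A'" "q' = (\<lambda>x. A' x + c')"
      and v: "\<forall>k\<in>{1..3}. q (gauss_point p e k) = v k" "\<forall>k\<in>{1..3}. q' (gauss_point p e k) = v k"
      unfolding P_def by blast
    show "q = q'"
    proof
      fix x
      define y where "y = 2 *\<^sub>R (x - s)"
      have y: "x = (1/2) *\<^sub>R y + s" by (simp add: y_def)
      have half: "linear (\<lambda>x. (1/2) *\<^sub>R A x)" "linear (\<lambda>x. (1/2) *\<^sub>R A' x)"
        using A by (auto intro: linear_compose_scale_right)
      have expand: "A ((1/2) *\<^sub>R z + s) + c = (1/2) *\<^sub>R A z + (A s + c)"
        "A' ((1/2) *\<^sub>R z + s) + c' = (1/2) *\<^sub>R A' z + (A' s + c')" for z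
        using A by (simp_all add: linear_add linear_scale)
      have "(1/2) *\<^sub>R A y + (A s + c) = (1/2) *\<^sub>R A' y + (A' s + c')"
      proof (rule affine_maps_eqI[OF half vertices(5)[OF e]])
        fix z assume "z \<in> p e ` {1..3}"
        then obtain k where "k \<in> {1..3}" "z = p e k" by blast
        with v A show "(1/2) *\<^sub>R A z + (A s + c) = (1/2) *\<^sub>R A' z + (A' s + c')"
          by (simp only: G flip: expand)
      qed
      then show "q x = q' x" unfolding A y expand .
    qed
  qed
  then have "P (THE q. P q)" by (rule theI')
  moreover have "sse_gradient \<T> p u e = (THE q. P q)" unfolding sse_gradient_def P_def v_def ..
  ultimately show ?thesis using k unfolding P_def v_def by simp
qed

lemma sse_form_self:
  "sse_form \<T> p u u = (\<Sum>e\<in>\<T>. area e / 3 * (\<Sum>k = 1..3.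
    (norm ((1/2) *\<^sub>R (edge_strain \<T> p u e (prev_vertex k) + edge_strain \<T> p u e k)))\<^sup>2))"
  unfolding sse_form_def power2_norm_eq_inner
  by (intro sum.cong refl arg_cong2[where f = "(*)"]) (simp_all only: sse_gradient_gauss_point)

text \<open>A pair is determined by the ordered endpoints of the common edge, since at most two
  elements share that edge. The endpoints are vertices of \<open>e'\<close>, which leaves at most 3
  times 3 choices.\<close>

lemma card_neighbor_pairs:
  assumes e': "e' \<in> \<T>"
  shows "card {(e, k). e \<in> \<T> \<and> k \<in> {1..3} \<and> is_neighbor \<T> p e k e'} \<le> 9"
proof -
  define N where "N = {(e, k). e \<in> \<T> \<and> k \<in> {1..3} \<and> is_neighbor \<T> p e k e'}"
  define C where "C = p e' ` {1..3}"
  define ends where "ends = (\<lambda>(e, k). (p e k, p e (next_vertex k)))"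
  have "ends ` N \<subseteq> C \<times> C"
  proof clarify
    fix e k a b assume "(e, k) \<in> N" "(a, b) = ends (e, k)"
    then have ek: "e \<in> \<T>" "k \<in> {1..3}" "is_neighbor \<T> p e k e'" "a = p e k" "b = p e (next_vertex k)"
      by (auto simp: N_def ends_def)
    then have seg: "e \<inter> e' = closed_segment a b" by (simp add: is_neighbor_def edge_def)
    \<comment> \<open>Conformity makes the common edge a face of \<open>e'\<close>, so its endpoints
      are extreme in \<open>e'\<close> as well.\<close>
    have "e' \<inter> e face_of e'" using element_Int_face e' ek(1) by blast
    then have face: "closed_segment a b face_of e'" using seg by (simp add: Int_commute)
    have "x \<in> C" if "x = a \<or> x = b" for x
    proof -
      have "x extreme_point_of (closed_segment a b)"
        using that by (simp add: segment_convex_hull extreme_point_of_convex_hull_2)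
      then have "x extreme_point_of e'" using extreme_point_of_face[OF face] by simp
      then show ?thesis unfolding C_def vertices(2)[OF e'] by simp
    qed
    then show "a \<in> C \<and> b \<in> C" by blast
  qed
  moreover have "inj_on ends N"
  proof (rule inj_onI, clarify)
    fix e\<^sub>1 k\<^sub>1 e\<^sub>2 k\<^sub>2
    assume N: "(e\<^sub>1, k\<^sub>1) \<in> N" "(e\<^sub>2, k\<^sub>2) \<in> N" and eq: "ends (e\<^sub>1, k\<^sub>1) = ends (e\<^sub>2, k\<^sub>2)"
    have 1: "e\<^sub>1 \<in> \<T>" "k\<^sub>1 \<in> {1..3}" "is_neighbor \<T> p e\<^sub>1 k\<^sub>1 e'"
      and 2: "e\<^sub>2 \<in> \<T>" "k\<^sub>2 \<in> {1..3}" "is_neighbor \<T> p e\<^sub>2 k\<^sub>2 e'"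
      using N unfolding N_def by blast+
    have eq': "p e\<^sub>1 k\<^sub>1 = p e\<^sub>2 k\<^sub>2" "p e\<^sub>1 (next_vertex k\<^sub>1) = p e\<^sub>2 (next_vertex k\<^sub>2)"
      using eq by (simp_all add: ends_def)
    have "e\<^sub>1 = e\<^sub>2"
    proof (rule segment_shared_by_at_most_two[OF e' 1(1) 2(1)])
      show "e\<^sub>1 \<noteq> e'" "e\<^sub>2 \<noteq> e'" using neighbor_contains_edge(2) 1(3) 2(3) by blast+
      show "p e\<^sub>1 k\<^sub>1 \<noteq> p e\<^sub>1 (next_vertex k\<^sub>1)" using edge_nondegenerate 1 by blast
      show "{p e\<^sub>1 k\<^sub>1, p e\<^sub>1 (next_vertex k\<^sub>1)} \<subseteq> e'"
        using neighbor_contains_edge(3,4)[OF 1(3)] by blast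
      show "{p e\<^sub>1 k\<^sub>1, p e\<^sub>1 (next_vertex k\<^sub>1)} \<subseteq> e\<^sub>1"
        using vertex_in_element[OF 1(1) 1(2)] vertex_in_element[OF 1(1) next_vertex_in[OF 1(2)]] by blast
      show "{p e\<^sub>1 k\<^sub>1, p e\<^sub>1 (next_vertex k\<^sub>1)} \<subseteq> e\<^sub>2"
        unfolding eq'
        using vertex_in_element[OF 2(1) 2(2)] vertex_in_element[OF 2(1) next_vertex_in[OF 2(2)]] by blast
    qed
    moreover have "k\<^sub>1 = k\<^sub>2"
      using inj_onD[OF vertices(1)[OF 1(1)], of k\<^sub>1 k\<^sub>2] eq'(1) calculation 1(2) 2(2) by blast
    ultimately show "e\<^sub>1 = e\<^sub>2 \<and> k\<^sub>1 = k\<^sub>2" by blast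
  qed
  moreover have fin: "finite (C \<times> C)" by (simp add: C_def)
  ultimately have "card N \<le> card (C \<times> C)" using card_inj_on_le by blast
  moreover have "card C \<le> 3" unfolding C_def using card_image_le[of "{1..3}" "p e'"] by simp
  then have "card C * card C \<le> 3 * 3" by (intro mult_mono) auto
  ultimately show ?thesis by (simp add: card_cartesian_product N_def)
qed

text \<open>Double counting: after exchanging the sums, \<open>w e'\<close> is charged once for
  every pair that has \<open>e'\<close> as its neighbour.\<close>

lemma sum_neighbors_le:
  fixes w :: "plane set \<Rightarrow> real"
  assumes w: "\<And>e. e \<in> \<T> \<Longrightarrow> 0 \<le> w e"
  shows "(\<Sum>e\<in>\<T>. \<Sum>k = 1..3. \<Sum>e' | is_neighbor \<T> p e k e'. w e') \<le> 9 * (\<Sum>e\<in>\<T>. w e)"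
proof -
  have nb: "{e'. is_neighbor \<T> p e k e'} = {e' \<in> \<T>. is_neighbor \<T> p e k e'}" for e k
    by (auto simp: is_neighbor_def)
  have "(\<Sum>e\<in>\<T>. \<Sum>k = 1..3. \<Sum>e' | is_neighbor \<T> p e k e'. w e')
      = (\<Sum>e\<in>\<T>. \<Sum>k = 1..3. \<Sum>e'\<in>\<T>. if is_neighbor \<T> p e k e' then w e' else 0)"
    unfolding nb sum.inter_filter[OF finite_elements] ..
  also have "\<dots> = (\<Sum>(e, k)\<in>\<T> \<times> {1..3}. \<Sum>e'\<in>\<T>. if is_neighbor \<T> p e k e' then w e' else 0)"
    by (rule sum.cartesian_product)
  also have "\<dots> = (\<Sum>e'\<in>\<T>. \<Sum>(e, k)\<in>\<T> \<times> {1..3}. if is_neighbor \<T> p e k e' then w e' else 0)"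
    unfolding case_prod_beta by (rule sum.swap)
  also have "\<dots> \<le> (\<Sum>e'\<in>\<T>. 9 * w e')"
  proof (rule sum_mono)
    fix e' assume e': "e' \<in> \<T>"
    have "(\<Sum>(e, k)\<in>\<T> \<times> {1..3}. if is_neighbor \<T> p e k e' then w e' else 0)
        = (\<Sum>x\<in>\<T> \<times> {1..3}. if is_neighbor \<T> p (fst x) (snd x) e' then w e' else 0)"
      by (simp add: case_prod_beta)
    also have "\<dots> = (\<Sum>x\<in>{x \<in> \<T> \<times> {1..3}. is_neighbor \<T> p (fst x) (snd x) e'}. w e')"
      using finite_elements by (intro sum.inter_filter[symmetric]) auto
    also have "{x \<in> \<T> \<times> {1..3}. is_neighbor \<T> p (fst x) (snd x) e'}
        = {(e, k). e \<in> \<T> \<and> k \<in> {1..3} \<and> is_neighbor \<T> p e k e'}" by auto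
    also have "(\<Sum>x\<in>\<dots>. w e') \<le> 9 * w e'"
      using card_neighbor_pairs[OF e'] w[OF e'] by (simp add: mult_right_mono)
    finally show "(\<Sum>(e, k)\<in>\<T> \<times> {1..3}. if is_neighbor \<T> p e k e' then w e' else 0) \<le> 9 * w e'" .
  qed
  finally show ?thesis by (simp add: sum_distrib_left)
qed

text \<open>The constant 4 is (3 + 9)/3: three edges of the element itself, at most nine charges as
  a neighbour, and the quadrature weight 1/3.\<close>

lemma sse_form_le_fem_form:
  assumes u: "piecewise_affine u"
  shows "sse_form \<T> p u u \<le> 4 * fem_form \<Omega> u u"
proof -
  define w where "w e = area e * (norm (elem_grad u e))\<^sup>2" for e
  have "sse_form \<T> p u u \<le> (\<Sum>e\<in>\<T>. area e / 3 * (\<Sum>k = 1..3. (norm (edge_strain \<T> p u e k))\<^sup>2))"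
    unfolding sse_form_self using element_area_pos
    by (intro sum_mono mult_left_mono averages_le_edge_values) (auto simp: less_imp_le)
  also have "\<dots> = (\<Sum>e\<in>\<T>. \<Sum>k = 1..3. area e * (norm (edge_strain \<T> p u e k))\<^sup>2) / 3"
    by (simp add: sum_distrib_left sum_divide_distrib)
  also have "\<dots> \<le> (\<Sum>e\<in>\<T>. \<Sum>k = 1..3. w e + (\<Sum>e' | is_neighbor \<T> p e k e'. w e')) / 3"
    unfolding w_def by (intro divide_right_mono sum_mono edge_strain_norm_le) auto
  also have "\<dots> = (3 * (\<Sum>e\<in>\<T>. w e) + (\<Sum>e\<in>\<T>. \<Sum>k = 1..3. \<Sum>e' | is_neighbor \<T> p e k e'. w e')) / 3"
    by (simp add: sum.distrib sum_distrib_left)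
  also have "\<dots> \<le> (3 * (\<Sum>e\<in>\<T>. w e) + 9 * (\<Sum>e\<in>\<T>. w e)) / 3"
    using element_area_pos by (intro divide_right_mono add_left_mono sum_neighbors_le) (auto simp: w_def less_imp_le)
  finally show ?thesis by (simp add: fem_form_self[OF u] w_def)
qed

text \<open>In \<open>36 * \<sigma>\<^sup>2\<close>, the factor \<open>4 * \<sigma>\<^sup>2\<close>
  is the square of the loss \<open>2 * \<sigma>\<close> in passing from the gradient to its
  component along one edge; one factor 3 comes from recovering edge values from averages, the other
  from the quadrature weight.\<close>

lemma fem_form_le_sse_form:
  assumes u: "piecewise_affine u" and \<sigma>: "0 < \<sigma>"
    and shape: "\<And>e. e \<in> \<T> \<Longrightarrow> diameter e \<le> \<sigma> * inscribed_diameter e"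
  shows "1 / (36 * \<sigma>\<^sup>2) * fem_form \<Omega> u u \<le> sse_form \<T> p u u"
proof -
  have local: "(norm (elem_grad u e))\<^sup>2 / (4 * \<sigma>\<^sup>2) \<le> 3 * (\<Sum>k = 1..3.
      (norm ((1/2) *\<^sub>R (edge_strain \<T> p u e (prev_vertex k) + edge_strain \<T> p u e k)))\<^sup>2)"
    if e: "e \<in> \<T>" for e
  proof -
    define R where "R = {2 * r |r. 0 \<le> r \<and> (\<exists>x. cball x r \<subseteq> e)}"
    have bdd: "bounded e" using element_compact[OF e] by (rule compact_imp_bounded)
    have "p e 1 \<noteq> p e 2" using edge_nondegenerate[OF e, of 1] by (simp add: numeral_2_eq_2)
    then have "0 < dist (p e 1) (p e 2)" by simp
    also have "\<dots> \<le> diameter e"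
      using bdd vertex_in_element[OF e] by (intro diameter_bounded_bound) auto
    finally have D: "0 < diameter e" .
    have "p e 1 \<in> e" using vertex_in_element[OF e, of 1] by simp
    then have "R \<noteq> {}" unfolding R_def by (auto intro!: exI[of _ 0] exI[of _ "p e 1"])
    \<comment> \<open>The inscribed diameter is a supremum. Giving away a factor 2 yields an actual
      disc without having to show that the supremum is attained.\<close>
    moreover have "diameter e / (2 * \<sigma>) < Sup R"
    proof -
      have "diameter e / (2 * \<sigma>) < diameter e / \<sigma>" using D \<sigma> by (simp add: field_simps)
      also have "\<dots> \<le> Sup R"
        using shape[OF e] \<sigma> by (simp add: inscribed_diameter_def R_def field_simps)
      finally show ?thesis .
    qed
    ultimately obtain s where s: "s \<in> R" "diameter e / (2 * \<sigma>) < s" using less_cSupE by blast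
    then obtain r x where r: "s = 2 * r" "0 \<le> r" "cball x r \<subseteq> e" unfolding R_def by blast
    obtain k where k: "k \<in> {1..3}" and width: "2 * r * norm (elem_grad u e)
        \<le> \<bar>inner (elem_grad u e) (p e (next_vertex k) - p e k)\<bar>"
      using triangle_width[of x r "p e" "elem_grad u e"] r(2,3) vertices(4)[OF e] by metis
    have "dist (p e (next_vertex k)) (p e k) \<le> diameter e"
      using bdd vertex_in_element[OF e next_vertex_in[OF k]] vertex_in_element[OF e k]
      by (intro diameter_bounded_bound) auto
    then have len: "norm (p e (next_vertex k) - p e k) \<le> diameter e" by (simp add: dist_norm)
    have "diameter e / (2 * \<sigma>) * norm (elem_grad u e) \<le> 2 * r * norm (elem_grad u e)"
      using s(2) r(1) by (intro mult_right_mono) auto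
    also note width
    \<comment> \<open>From here on only the component along edge \<open>k\<close> is involved, where
      the gradient and the smoothed strain coincide.\<close>
    also have "\<bar>inner (elem_grad u e) (p e (next_vertex k) - p e k)\<bar>
        = \<bar>inner (edge_strain \<T> p u e k) (p e (next_vertex k) - p e k)\<bar>"
      using edge_strain_tangential[OF u e k] by simp
    also have "\<dots> \<le> norm (edge_strain \<T> p u e k) * norm (p e (next_vertex k) - p e k)"
      by (rule Cauchy_Schwarz_ineq2)
    also have "\<dots> \<le> norm (edge_strain \<T> p u e k) * diameter e"
      using len by (intro mult_left_mono) auto
    finally have "diameter e * (norm (elem_grad u e) / (2 * \<sigma>)) \<le> diameter e * norm (edge_strain \<T> p u e k)"
      by (simp add: mult.commute)
    then have "norm (elem_grad u e) / (2 * \<sigma>) \<le> norm (edge_strain \<T> p u e k)"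
      using D by (rule mult_left_le_imp_le)
    then have "(norm (elem_grad u e) / (2 * \<sigma>))\<^sup>2 \<le> (norm (edge_strain \<T> p u e k))\<^sup>2"
      using \<sigma> by (intro power_mono) auto
    then have "(norm (elem_grad u e))\<^sup>2 / (4 * \<sigma>\<^sup>2) \<le> (norm (edge_strain \<T> p u e k))\<^sup>2"
      by (simp add: power_divide power_mult_distrib)
    also note edge_value_le_averages[OF k, where v = "edge_strain \<T> p u e"]
    finally show ?thesis .
  qed
  have "1 / (36 * \<sigma>\<^sup>2) * fem_form \<Omega> u u
      = (\<Sum>e\<in>\<T>. area e / 9 * ((norm (elem_grad u e))\<^sup>2 / (4 * \<sigma>\<^sup>2)))"
    by (simp add: fem_form_self[OF u] sum_divide_distrib)
  also have "\<dots> \<le> (\<Sum>e\<in>\<T>. area e / 9 * (3 * (\<Sum>k = 1..3.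
      (norm ((1/2) *\<^sub>R (edge_strain \<T> p u e (prev_vertex k) + edge_strain \<T> p u e k)))\<^sup>2)))"
    using local element_area_pos by (intro sum_mono mult_left_mono) (auto simp: less_imp_le)
  also have "\<dots> = sse_form \<T> p u u" unfolding sse_form_self by (intro sum.cong) auto
  finally show ?thesis .
qed

end

section \<open>Nodal interpolation\<close>

text \<open>Two points may lie in different pieces, so the pieces are not compared directly. On the
  segment joining the points, the cover induces finitely many closed sets of parameters, and
  Lipschitz bounds on an interval can be glued with the same constant.\<close>

lemma lipschitz_on_finite_closed_cover:
  fixes f :: "'a::real_normed_vector \<Rightarrow> 'b::metric_space"
  assumes "finite S" "\<Union>S = UNIV" "0 \<le> M"
    and S: "\<And>s. s \<in> S \<Longrightarrow> closed s" "\<And>s. s \<in> S \<Longrightarrow> M-lipschitz_on s f"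
  shows "M-lipschitz_on UNIV f"
proof (rule lipschitz_onI)
  fix x y :: 'a
  define \<phi> where "\<phi> = (\<lambda>t::real. x + t *\<^sub>R (y - x))"
  have cont: "continuous_on UNIV \<phi>" unfolding \<phi>_def by (intro continuous_intros)
  have "(M * dist x y)-lipschitz_on {0..1} (f \<circ> \<phi>)"
  proof (rule lipschitz_on_closed_Union[where I = S and U = "\<lambda>s. \<phi> -` s"])
    show "{0..1} \<subseteq> (\<Union>s\<in>S. \<phi> -` s)" using assms(2) by blast
    fix s assume s: "s \<in> S"
    show "closed (\<phi> -` s)" using closed_vimage[OF S(1)[OF s] cont] .
    show "(M * dist x y)-lipschitz_on (\<phi> -` s) (f \<circ> \<phi>)"
    proof (rule lipschitz_onI)
      fix t t' assume "t \<in> \<phi> -` s" "t' \<in> \<phi> -` s"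
      then have "dist (f (\<phi> t)) (f (\<phi> t')) \<le> M * dist (\<phi> t) (\<phi> t')"
        using lipschitz_onD[OF S(2)[OF s]] by simp
      also have "\<phi> t - \<phi> t' = (t - t') *\<^sub>R (y - x)" by (simp add: \<phi>_def scaleR_diff_left)
      then have "dist (\<phi> t) (\<phi> t') = dist t t' * dist x y"
        by (simp add: dist_norm norm_minus_commute)
      finally show "dist ((f \<circ> \<phi>) t) ((f \<circ> \<phi>) t') \<le> M * dist x y * dist t t'"
        by (simp add: mult_ac)
    qed (use assms(3) in simp)
  qed (use assms in auto)
  then have "dist ((f \<circ> \<phi>) 0) ((f \<circ> \<phi>) 1) \<le> M * dist x y * dist (0::real) 1"
    by (rule lipschitz_onD) auto
  then show "dist (f x) (f y) \<le> M * dist x y" by (simp add: \<phi>_def dist_norm)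
qed (rule assms)

context mesh
begin

text \<open>The elements containing a point of the relative interior of a face contain the whole
  face; hence near any two such points the union of the elements looks alike, and either both or
  neither are interior points.\<close>

lemma face_rel_interior_in_domain:
  assumes e: "e \<in> \<T>" and F: "F face_of e" and meets: "F \<inter> \<Omega> \<noteq> {}" and x: "x \<in> rel_interior F"
  shows "x \<in> \<Omega>"
proof -
  have Fc: "convex F" using F by (rule face_of_imp_convex)
  \<comment> \<open>The relative interior is dense in \<open>F\<close>, so the open set
    \<open>\<Omega>\<close> meets it too.\<close>
  have "\<Omega> \<inter> closure (rel_interior F) \<noteq> {}"
    using meets convex_closure_rel_interior[OF Fc] closure_subset[of F] by blast
  then obtain y where y: "y \<in> rel_interior F" "y \<in> \<Omega>"
    using open_Int_closure_eq_empty[OF domain_open] by blast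
  have "closed (\<Union>{e' \<in> \<T>. y \<notin> e'})"
    using finite_elements element_closed by (intro closed_Union) auto
  then have "open (\<Omega> - \<Union>{e' \<in> \<T>. y \<notin> e'})" using domain_open by (rule open_Diff[rotated])
  moreover have "y \<in> \<Omega> - \<Union>{e' \<in> \<T>. y \<notin> e'}" using y by blast
  ultimately obtain \<delta> where \<delta>: "0 < \<delta>" "ball y \<delta> \<subseteq> \<Omega> - \<Union>{e' \<in> \<T>. y \<notin> e'}"
    by (meson open_contains_ball)
  have near: "\<exists>e'\<in>\<T>. w \<in> e' \<and> F \<subseteq> e'" if "w \<in> ball y \<delta>" for w
  proof -
    have "w \<in> closure \<Omega>" using that \<delta>(2) closure_subset by blast
    then obtain e' where e': "e' \<in> \<T>" "w \<in> e'" using elements_cover by blast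
    then have "y \<in> e'" using that \<delta>(2) by blast
    then have "(e \<inter> e') \<inter> rel_interior F \<noteq> {}"
      using y(1) rel_interior_subset[of F] face_of_imp_subset[OF F] by blast
    then have "F \<subseteq> e \<inter> e'"
      using subset_of_face_of[OF element_Int_face[OF e e'(1)] face_of_imp_subset[OF F]] by blast
    with e' show ?thesis by blast
  qed
  have "y \<in> affine hull F" using y(1) rel_interior_subset[of F] hull_inc[of y F] by blast
  \<comment> \<open>The segment from \<open>y\<close> to \<open>x\<close> is prolonged beyond
    \<open>x\<close> within \<open>F\<close>; its endpoint \<open>f\<close> is the centre of the
    homothety that carries \<open>y\<close> to \<open>x\<close>.\<close>
  then obtain m where m: "1 < m" "(1 - m) *\<^sub>R y + m *\<^sub>R x \<in> F"
    using convex_rel_interior_if[OF Fc x] by blast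
  define f where "f = (1 - m) *\<^sub>R y + m *\<^sub>R x"
  have xf: "x = (1 / m) *\<^sub>R f + (1 - 1 / m) *\<^sub>R y"
    using m(1) by (simp add: f_def scaleR_add_right scaleR_diff_left scaleR_diff_right)
  define t where "t = 1 - 1 / m"
  have pos: "0 < t" and mt: "1 / m + t = 1" "0 \<le> 1 / m" using m(1) by (simp_all add: t_def)
  have xf: "x = (1 / m) *\<^sub>R f + t *\<^sub>R y" unfolding t_def by (rule xf)
  have "ball x (t * \<delta>) \<subseteq> closure \<Omega>"
  proof
    fix w assume w: "w \<in> ball x (t * \<delta>)"
    \<comment> \<open>The preimage of \<open>w\<close> under the homothety with centre
      \<open>f\<close> and ratio \<open>t\<close>. It is close to \<open>y\<close>, so some element
      contains both \<open>z\<close> and \<open>F\<close>, and by convexity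
      \<open>w\<close>.\<close>
    define z where "z = y + (1 / t) *\<^sub>R (w - x)"
    have "norm (w - x) < t * \<delta>" using w by (simp add: dist_norm norm_minus_commute)
    then have "norm (w - x) / t < \<delta>" using pos by (simp add: pos_divide_less_eq mult.commute)
    then have "z \<in> ball y \<delta>" using pos by (simp add: z_def dist_norm)
    then obtain e' where e': "e' \<in> \<T>" "z \<in> e'" "F \<subseteq> e'" using near by blast
    have "t *\<^sub>R z = t *\<^sub>R y + (w - x)"
      using pos by (simp add: z_def scaleR_add_right)
    then have "w = (1 / m) *\<^sub>R f + t *\<^sub>R z"
      unfolding xf by simp
    moreover have fe: "f \<in> e'" using m(2) e'(3) by (auto simp: f_def)
    ultimately have "w \<in> e'"
      using convexD[OF element_convex[OF e'(1)] fe e'(2), of "1 / m" t] mt pos by simp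
    with e'(1) show "w \<in> closure \<Omega>" using elements_cover by blast
  qed
  moreover have "x \<in> ball x (t * \<delta>)" using pos \<delta>(1) by simp
  ultimately have "x \<in> interior (closure \<Omega>)" using mem_interior pos \<delta>(1) mult_pos_pos by blast
  then show ?thesis by (simp add: interior_closure_domain)
qed

text \<open>Two elements meet in a common face, which is the convex hull of its extreme points;
  these are vertices of both, so the local interpolants agree on it. Vanishing of \<open>f\<close>
  at boundary vertices alone must also force zero boundary values, which needs
  \<open>face_rel_interior_in_domain\<close>.\<close>

lemma nodal_interpolant:
  fixes f :: "plane \<Rightarrow> real"
  assumes f: "\<And>x. x \<notin> \<Omega> \<Longrightarrow> f x = 0"
  obtains v where "piecewise_affine v" "\<And>x. x \<notin> \<Omega> \<Longrightarrow> v x = 0"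
    "\<And>e x. e \<in> \<T> \<Longrightarrow> x extreme_point_of e \<Longrightarrow> v x = f x"
proof -
  have "\<exists>g c. \<forall>x. x extreme_point_of e \<longrightarrow> f x = inner g x + c" if e: "e \<in> \<T>" for e
  proof -
    obtain C where "\<not> affine_dependent C" "C = {x. x extreme_point_of e}"
      using two_simplex_vertices[OF element_simplex[OF e]] by metis
    then obtain g c where "\<And>x. x \<in> C \<Longrightarrow> f x = inner g x + c" "C = {x. x extreme_point_of e}"
      using affine_interpolation_real[of C f] by metis
    then show ?thesis by blast
  qed
  then obtain g c where gc: "\<And>e x. e \<in> \<T> \<Longrightarrow> x extreme_point_of e \<Longrightarrow> f x = inner (g e) x + c e"
    by metis
  have agree: "inner (g e) x + c e = inner (g e') x + c e'"
    if e: "e \<in> \<T>" "e' \<in> \<T>" and x: "x \<in> e" "x \<in> e'" for e e' x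
  proof -
    define F where "F = e \<inter> e'"
    have F: "F face_of e" "F face_of e'"
      unfolding F_def using element_Int_face[OF e] element_Int_face[OF e(2,1)]
      by (simp_all only: Int_commute)
    have "compact F" "convex F"
      unfolding F_def using e element_compact element_closed element_convex
      by (auto intro: compact_Int_closed convex_Int)
    then have "x \<in> convex hull {z. z extreme_point_of F}"
      using Krein_Milman_Minkowski[of F] x unfolding F_def by blast
    moreover have "{z. z extreme_point_of F} \<subseteq> {z. inner (g e - g e') z = c e' - c e}"
    proof clarify
      fix z assume "z extreme_point_of F"
      then have z: "z extreme_point_of e" "z extreme_point_of e'"
        using extreme_point_of_face F by blast+
      show "inner (g e - g e') z = c e' - c e"
        using gc[OF e(1) z(1)] gc[OF e(2) z(2)] by (simp add: inner_diff_left)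
    qed
    then have "convex hull {z. z extreme_point_of F} \<subseteq> {z. inner (g e - g e') z = c e' - c e}"
      by (intro hull_minimal convex_hyperplane)
    ultimately have "inner (g e - g e') x = c e' - c e" by blast
    then show ?thesis by (simp add: inner_diff_left)
  qed
  \<comment> \<open>The extension by zero to the whole plane is what mollification will act on;
    \<open>agree\<close> makes the choice of the element immaterial.\<close>
  define v where "v x = (if x \<in> \<Omega> then let e = (SOME e. e \<in> \<T> \<and> x \<in> e) in inner (g e) x + c e else 0)" for x
  have outside: "inner (g e) x + c e = 0" if e: "e \<in> \<T>" "x \<in> e" and x: "x \<notin> \<Omega>" for e x
  proof -
    obtain C where C: "\<not> affine_dependent C" "finite C" "e = convex hull C" "C = {x. x extreme_point_of e}"
      using two_simplex_vertices[OF element_simplex[OF e(1)]] by metis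
    have "x \<in> convex hull C" using C(3) e(2) by (rule subst)
    then obtain l where l: "\<And>z. z \<in> C \<Longrightarrow> 0 \<le> l z" "sum l C = 1" "(\<Sum>z\<in>C. l z *\<^sub>R z) = x"
      unfolding convex_hull_finite[OF C(2)] by blast
    \<comment> \<open>These vertices span the smallest face containing \<open>x\<close>. If that
      face met \<open>\<Omega>\<close>, then \<open>x\<close>, in its relative interior, would lie
      in \<open>\<Omega>\<close>; so all its vertices are outside \<open>\<Omega>\<close>, where
      \<open>f\<close> is zero.\<close>
    define D where "D = {z \<in> C. 0 < l z}"
    have D: "D \<subseteq> C" by (auto simp: D_def)
    have zero: "l z = 0" if "z \<in> C - D" for z using l(1)[of z] that unfolding D_def by fastforce
    have "sum l D = 1" "(\<Sum>z\<in>D. l z *\<^sub>R z) = x"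
      using l(2,3) zero C(2) D by (simp_all add: sum.mono_neutral_left[of C D])
    then have xD: "x \<in> rel_interior (convex hull D)"
      unfolding rel_interior_convex_hull_explicit[OF affine_independent_subset[OF C(1) D]]
      unfolding D_def by blast
    have face: "convex hull D face_of e"
      unfolding C(3) using face_of_convex_hull_affine_independent[OF C(1)] D by blast
    have disj: "convex hull D \<inter> \<Omega> = {}"
      using face_rel_interior_in_domain[OF e(1) face _ xD] x by blast
    have "D \<subseteq> {z. inner (g e) z = - c e}"
    proof
      fix z assume z: "z \<in> D"
      then have "z \<notin> \<Omega>" using disj hull_inc[of z D convex] by blast
      moreover have "z extreme_point_of e" using z D C(4) by blast
      ultimately show "z \<in> {z. inner (g e) z = - c e}" using gc[OF e(1)] f by fastforce
    qed
    then have "convex hull D \<subseteq> {z. inner (g e) z = - c e}"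
      by (intro hull_minimal convex_hyperplane)
    then show ?thesis using xD rel_interior_subset by fastforce
  qed
  have v: "v x = inner (g e) x + c e" if e: "e \<in> \<T>" "x \<in> e" for e x
  proof (cases "x \<in> \<Omega>")
    case True
    have "(SOME e. e \<in> \<T> \<and> x \<in> e) \<in> \<T> \<and> x \<in> (SOME e. e \<in> \<T> \<and> x \<in> e)"
      using e by (intro someI[of "\<lambda>e. e \<in> \<T> \<and> x \<in> e" e]) blast
    then show ?thesis
      using True agree[OF _ e(1) _ e(2)] unfolding v_def Let_def by simp
  next
    case False
    then show ?thesis using outside[OF e] by (simp add: v_def)
  qed
  show ?thesis
  proof
    show "piecewise_affine v" unfolding piecewise_affine_def using v by blast
    show "v x = 0" if "x \<notin> \<Omega>" for x using that by (simp add: v_def)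
    show "v x = f x" if "e \<in> \<T>" "x extreme_point_of e" for e x
      using that gc v[OF that(1)] by (auto simp: extreme_point_of_def)
  qed
qed

text \<open>The elements and the complement of \<open>\<Omega>\<close> form a finite closed cover of
  the plane, and on the complement the function is zero.\<close>

lemma piecewise_affine_lipschitz:
  assumes v: "piecewise_affine v" and zero: "\<And>x. x \<notin> \<Omega> \<Longrightarrow> v x = 0"
  obtains M where "M-lipschitz_on UNIV v"
proof -
  define M where "M = (\<Sum>e\<in>\<T>. norm (elem_grad v e))"
  have M: "0 \<le> M" by (simp add: M_def sum_nonneg)
  have "M-lipschitz_on UNIV v"
  proof (rule lipschitz_on_finite_closed_cover[of "insert (- \<Omega>) \<T>"])
    show "\<Union>(insert (- \<Omega>) \<T>) = UNIV"
      using elements_cover closure_subset[of \<Omega>] by auto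
    fix s assume "s \<in> insert (- \<Omega>) \<T>"
    then consider "s = - \<Omega>" | "s \<in> \<T>" by blast
    then show "M-lipschitz_on s v"
    proof cases
      case 1
      then show ?thesis using zero M by (intro lipschitz_onI) auto
    next
      case 2
      show ?thesis
      proof (rule lipschitz_onI)
        fix x y assume "x \<in> s" "y \<in> s"
        then have "dist (v x) (v y) = \<bar>inner (elem_grad v s) (x - y)\<bar>"
          using elem_grad_diff[OF v 2] by (simp add: dist_real_def)
        also have "\<dots> \<le> norm (elem_grad v s) * norm (x - y)" by (rule Cauchy_Schwarz_ineq2)
        also have "\<dots> \<le> M * norm (x - y)"
          unfolding M_def using 2 finite_elements
          by (intro mult_right_mono member_le_sum) auto
        finally show "dist (v x) (v y) \<le> M * dist x y" by (simp add: dist_norm)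
      qed (rule M)
    qed
    show "closed s" using \<open>s \<in> insert (- \<Omega>) \<T>\<close> domain_open element_closed by auto
  qed (use finite_elements M in auto)
  then show ?thesis by (rule that)
qed

text \<open>The last conjunct is for the thresholds: where \<open>v\<close> vanishes on a
  neighbourhood they vanish as well, while a zero with nonzero gradient would be erased with its
  gradient at every level. Such zeros are confined to finitely many lines.\<close>

lemma AE_locally_affine:
  assumes v: "piecewise_affine v"
  defines "G \<equiv> \<lambda>x. \<Sum>e\<in>\<T>. indicator (interior e) x *\<^sub>R elem_grad v e"
  shows "G \<in> borel_measurable lebesgue"
    and "AE x in lebesgue. x \<in> \<Omega> \<longrightarrow>
      (\<exists>r>0. \<exists>c. \<forall>y\<in>ball x r. v y = inner (G x) y + c) \<and> (v x = 0 \<longrightarrow> G x = 0)"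
proof -
  have "interior e \<in> lmeasurable" if "e \<in> \<T>" for e
    using element_compact[OF that] by (simp add: compact_imp_bounded lmeasurable_interior)
  then show "G \<in> borel_measurable lebesgue"
    unfolding G_def by (intro borel_measurable_sum borel_measurable_scaleR borel_measurable_indicator) auto
  have "\<exists>c. \<forall>x\<in>e. v x = inner (elem_grad v e) x + c" if e: "e \<in> \<T>" for e
  proof -
    obtain c where "\<And>x. x \<in> e \<Longrightarrow> v x = inner (elem_grad v e) x + c"
      using piecewise_affineE[OF v e] by metis
    then show ?thesis by blast
  qed
  then obtain c where c: "\<And>e x. e \<in> \<T> \<Longrightarrow> x \<in> e \<Longrightarrow> v x = inner (elem_grad v e) x + c e"
    by metis
  define Z where "Z = (\<Union>e\<in>{e \<in> \<T>. elem_grad v e \<noteq> 0}. {x. inner (elem_grad v e) x = - c e})"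
  have "negligible Z"
    unfolding Z_def using finite_elements by (intro negligible_Union) (auto intro: negligible_hyperplane)
  then have "AE x in lebesgue. x \<notin> Z"
    unfolding negligible_iff_null_sets by (rule AE_not_in)
  with AE_interior_element show "AE x in lebesgue. x \<in> \<Omega> \<longrightarrow>
      (\<exists>r>0. \<exists>c. \<forall>y\<in>ball x r. v y = inner (G x) y + c) \<and> (v x = 0 \<longrightarrow> G x = 0)"
  proof eventually_elim
    case (elim x)
    show ?case
    proof
      assume "x \<in> \<Omega>"
      then obtain e where e: "e \<in> \<T>" "x \<in> interior e" using elim(1) by blast
      have Gx: "G x = elem_grad v e" unfolding G_def by (rule sum_indicator_interior[OF e])
      obtain r where r: "0 < r" "ball x r \<subseteq> e" using e(2) by (auto simp: mem_interior)
      then have "\<forall>y\<in>ball x r. v y = inner (G x) y + c e" using c[OF e(1)] Gx by auto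
      moreover have "G x = 0" if "v x = 0"
      proof (rule ccontr)
        assume "G x \<noteq> 0"
        moreover have "inner (elem_grad v e) x = - c e"
          using c[OF e(1), of x] e(2) interior_subset[of e] that by auto
        ultimately have "x \<in> Z" using e(1) Gx unfolding Z_def by auto
        with elim(2) show False by blast
      qed
      ultimately show "(\<exists>r>0. \<exists>c. \<forall>y\<in>ball x r. v y = inner (G x) y + c) \<and> (v x = 0 \<longrightarrow> G x = 0)"
        using r(1) by blast
    qed
  qed
qed

end

section \<open>Mollification\<close>

lemma has_field_derivative_max_square:
  "((\<lambda>s::real. (max 0 s)\<^sup>2) has_field_derivative 2 * max 0 s) (at s)"
proof -
  consider "s < 0" | "s = 0" | "0 < s" by linarith
  then show ?thesis
  proof cases
    case 1
    then have "((\<lambda>s::real. 0) has_field_derivative 2 * max 0 s) (at s)" by simp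
    moreover have "open {..<0::real}" "s \<in> {..<0}" using 1 by auto
    ultimately show ?thesis
      by (rule has_field_derivative_transform_within_open) auto
  next
    case 2
    have "((\<lambda>h::real. (max 0 h)\<^sup>2 / h) \<longlongrightarrow> 0) (at 0)"
    proof (rule Lim_null_comparison)
      show "eventually (\<lambda>h::real. norm ((max 0 h)\<^sup>2 / h) \<le> \<bar>h\<bar>) (at 0)"
        by (intro always_eventually) (auto simp: max_def power2_eq_square)
      show "((\<lambda>h::real. \<bar>h\<bar>) \<longlongrightarrow> 0) (at 0)" by (intro tendsto_rabs_zero tendsto_ident_at)
    qed
    with 2 show ?thesis by (simp add: DERIV_def)
  next
    case 3
    have "((\<lambda>s::real. s\<^sup>2) has_field_derivative 2 * max 0 s) (at s)"
      using 3 by (auto intro!: derivative_eq_intros)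
    moreover have "open {0::real<..}" "s \<in> {0<..}" using 3 by auto
    ultimately show ?thesis
      by (rule has_field_derivative_transform_within_open) auto
  qed
qed

text \<open>An unnormalised kernel supported in the closed ball of radius \<open>\<epsilon>\<close>.
  The square makes it continuously differentiable, the regularity demanded by
  \<open>C1_compact_support\<close>.\<close>

definition bump :: "real \<Rightarrow> plane \<Rightarrow> real" where
  "bump \<epsilon> z = (max 0 (\<epsilon>\<^sup>2 - inner z z))\<^sup>2"

lemma bump_nonneg: "0 \<le> bump \<epsilon> z"
  by (simp add: bump_def)

lemma bump_eq_0: "0 < \<epsilon> \<Longrightarrow> \<epsilon> \<le> norm z \<Longrightarrow> bump \<epsilon> z = 0"
  using power_mono[of \<epsilon> "norm z" 2] by (simp add: bump_def power2_norm_eq_inner max_def)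

lemma bump_pos: "norm z < \<epsilon> \<Longrightarrow> 0 < bump \<epsilon> z"
  using power_strict_mono[of "norm z" \<epsilon> 2] by (simp add: bump_def power2_norm_eq_inner max_def)

lemma continuous_bump: "continuous_on S (bump \<epsilon>)"
  unfolding bump_def by (intro continuous_intros)

lemma has_derivative_bump:
  "((\<lambda>x. bump \<epsilon> (y - x)) has_derivative (\<lambda>h. 4 * max 0 (\<epsilon>\<^sup>2 - inner (y - x) (y - x)) * inner (y - x) h)) (at x)"
proof -
  have "((\<lambda>x. \<epsilon>\<^sup>2 - inner (y - x) (y - x)) has_derivative (\<lambda>h. 2 * inner (y - x) h)) (at x)"
    by (auto intro!: derivative_eq_intros simp: inner_commute)
  from has_derivative_compose[OF this has_field_derivative_max_square[THEN has_field_derivative_imp_has_derivative]]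
  show ?thesis unfolding bump_def by (simp add: mult_ac)
qed

lemma integrable_bump_times:
  fixes f :: "plane \<Rightarrow> 'a::euclidean_space"
  assumes "0 < \<epsilon>" "continuous_on UNIV f"
  shows "integrable lborel (\<lambda>t. bump \<epsilon> t *\<^sub>R f t)"
proof -
  have "continuous_on (cball 0 \<epsilon>) (\<lambda>t. bump \<epsilon> t *\<^sub>R f t)"
    by (intro continuous_intros continuous_bump continuous_on_subset[OF assms(2)]) auto
  then have "integrable lborel (\<lambda>t. indicator (cball 0 \<epsilon>) t *\<^sub>R (bump \<epsilon> t *\<^sub>R f t))"
    by (intro borel_integrable_compact) auto
  also have "(\<lambda>t. indicator (cball 0 \<epsilon>) t *\<^sub>R (bump \<epsilon> t *\<^sub>R f t)) = (\<lambda>t. bump \<epsilon> t *\<^sub>R f t)"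
  proof
    fix t
    show "indicator (cball 0 \<epsilon>) t *\<^sub>R (bump \<epsilon> t *\<^sub>R f t) = bump \<epsilon> t *\<^sub>R f t"
      using bump_eq_0[OF assms(1), of t] by (cases "norm t \<le> \<epsilon>") (simp_all add: indicator_def)
  qed
  finally show ?thesis .
qed

lemma integral_bump_pos:
  assumes "0 < \<epsilon>"
  shows "0 < (LINT t|lborel. bump \<epsilon> t)"
proof -
  have int: "integrable lborel (bump \<epsilon>)"
    using integrable_bump_times[OF assms continuous_on_const[of UNIV "1::real"]] by simp
  have "(LINT t|lborel. bump \<epsilon> t) \<noteq> 0"
  proof
    assume "(LINT t|lborel. bump \<epsilon> t) = 0"
    then have "AE t in lborel. bump \<epsilon> t = 0"
      using integral_nonneg_eq_0_iff_AE[OF int] bump_nonneg by simp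
    then have "AE t in lborel. t \<notin> ball (0::plane) \<epsilon>"
    proof eventually_elim
      case (elim t)
      then show ?case using bump_pos[of t \<epsilon>] by auto
    qed
    then have "emeasure lborel (ball (0::plane) \<epsilon>) = 0"
      by (subst (asm) AE_iff_measurable[of "ball 0 \<epsilon>"]) auto
    then have "measure lborel (ball (0::plane) \<epsilon>) = 0" by (simp add: measure_def)
    with content_ball_pos[OF assms, of "0::plane"] show False by simp
  qed
  moreover have "0 \<le> (LINT t|lborel. bump \<epsilon> t)" by (intro Bochner_Integration.integral_nonneg bump_nonneg)
  ultimately show ?thesis by simp
qed

text \<open>Convolution with the normalised kernel, which is even. With the shift on
  \<open>f\<close>, the values are weighted averages of translates, so bounds on \<open>f\<close>
  pass over directly.\<close>

definition mollify :: "real \<Rightarrow> (plane \<Rightarrow> real) \<Rightarrow> plane \<Rightarrow> real" where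
  "mollify \<epsilon> f x = (LINT t|lborel. bump \<epsilon> t * f (x + t)) / (LINT t|lborel. bump \<epsilon> t)"

context
  fixes f :: "plane \<Rightarrow> real" and M \<epsilon> :: real
  assumes lip: "M-lipschitz_on UNIV f" and eps: "0 < \<epsilon>"
begin

lemma lipschitz_continuous: "continuous_on S f"
  using lipschitz_on_continuous_on[OF lip] continuous_on_subset by blast

lemma integrable_mollify: "integrable lborel (\<lambda>t. bump \<epsilon> t * f (x + t))"
proof -
  have "continuous_on UNIV (\<lambda>t. f (x + t))"
    by (rule continuous_on_compose2[OF lipschitz_continuous[of UNIV]]) (auto intro!: continuous_intros)
  from integrable_bump_times[OF eps this] show ?thesis by simp
qed

lemma integrable_bump: "integrable lborel (bump \<epsilon>)"
  using integrable_bump_times[OF eps continuous_on_const[of UNIV "1::real"]] by simp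

text \<open>With \<open>g\<close> constant, a translate of \<open>f\<close>, or zero, this one
  estimate yields closeness, preservation of the Lipschitz constant, and control of the
  support.\<close>

lemma mollify_diff_le:
  assumes "\<And>t. norm t < \<epsilon> \<Longrightarrow> \<bar>f (x + t) - g t\<bar> \<le> B"
    and "integrable lborel (\<lambda>t. bump \<epsilon> t * g t)"
  shows "\<bar>mollify \<epsilon> f x - (LINT t|lborel. bump \<epsilon> t * g t) / (LINT t|lborel. bump \<epsilon> t)\<bar> \<le> B"
proof -
  let ?N = "LINT t|lborel. bump \<epsilon> t"
  have N: "0 < ?N" by (rule integral_bump_pos[OF eps])
  have "\<bar>(LINT t|lborel. bump \<epsilon> t * f (x + t)) - (LINT t|lborel. bump \<epsilon> t * g t)\<bar>
      = norm (LINT t|lborel. bump \<epsilon> t * f (x + t) - bump \<epsilon> t * g t)"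
    using integrable_mollify assms(2) by (simp add: Bochner_Integration.integral_diff)
  also have "\<dots> \<le> (LINT t|lborel. norm (bump \<epsilon> t * f (x + t) - bump \<epsilon> t * g t))"
    by (rule integral_norm_bound)
  also have "\<dots> \<le> (LINT t|lborel. bump \<epsilon> t * B)"
  proof (rule integral_mono)
    show "integrable lborel (\<lambda>t. norm (bump \<epsilon> t * f (x + t) - bump \<epsilon> t * g t))"
      using integrable_mollify assms(2) by (intro integrable_norm Bochner_Integration.integrable_diff)
    show "integrable lborel (\<lambda>t. bump \<epsilon> t * B)" using integrable_bump by simp
    fix t
    show "norm (bump \<epsilon> t * f (x + t) - bump \<epsilon> t * g t) \<le> bump \<epsilon> t * B"
    proof (cases "norm t < \<epsilon>")
      case True
      then show ?thesis
        using mult_left_mono[OF assms(1) bump_nonneg[of \<epsilon> t]] bump_nonneg[of \<epsilon> t]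
        by (simp add: abs_mult flip: right_diff_distrib)
    next
      case False
      then show ?thesis using bump_eq_0[OF eps, of t] by simp
    qed
  qed
  also have "\<dots> = ?N * B" by simp
  finally have "\<bar>(LINT t|lborel. bump \<epsilon> t * f (x + t)) - (LINT t|lborel. bump \<epsilon> t * g t)\<bar> / ?N \<le> B"
    using N by (simp add: pos_divide_le_eq mult.commute)
  then show ?thesis using N by (simp add: mollify_def diff_divide_distrib[symmetric] abs_divide)
qed

lemma mollify_close: "\<bar>mollify \<epsilon> f x - f x\<bar> \<le> M * \<epsilon>"
proof -
  have "\<bar>mollify \<epsilon> f x - (LINT t|lborel. bump \<epsilon> t * f x) / (LINT t|lborel. bump \<epsilon> t)\<bar> \<le> M * \<epsilon>"
  proof (rule mollify_diff_le)
    fix t :: plane assume "norm t < \<epsilon>"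
    then have "M * dist (x + t) x \<le> M * \<epsilon>"
      using lipschitz_on_nonneg[OF lip] by (intro mult_left_mono) (auto simp: dist_norm)
    with lipschitz_onD[OF lip, of "x + t" x] show "\<bar>f (x + t) - f x\<bar> \<le> M * \<epsilon>"
      by (simp add: dist_real_def)
  qed (use integrable_bump in simp)
  then show ?thesis using integral_bump_pos[OF eps] by simp
qed

lemma mollify_lipschitz: "\<bar>mollify \<epsilon> f x - mollify \<epsilon> f y\<bar> \<le> M * dist x y"
  unfolding mollify_def[of \<epsilon> f y]
proof (rule mollify_diff_le[OF _ integrable_mollify])
  fix t :: plane
  show "\<bar>f (x + t) - f (y + t)\<bar> \<le> M * dist x y"
    using lipschitz_onD[OF lip, of "x + t" "y + t"] by (simp add: dist_real_def dist_norm)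
qed

text \<open>Averaging preserves affine functions up to an additive constant. The radius
  \<open>2 * \<epsilon>\<close> leaves a whole ball of radius \<open>\<epsilon>\<close> about
  \<open>x\<close> on which the averages see only the affine part, as a derivative at
  \<open>x\<close> requires.\<close>

lemma mollify_affine:
  assumes "\<And>y. y \<in> ball x (2 * \<epsilon>) \<Longrightarrow> f y = inner g y + c"
  shows "GDERIV (mollify \<epsilon> f) x :> g"
proof -
  let ?N = "LINT t|lborel. bump \<epsilon> t"
  define d where "d = (LINT t|lborel. bump \<epsilon> t * (inner g t + c)) / ?N"
  have int: "integrable lborel (\<lambda>t. bump \<epsilon> t * (inner g t + c))"
    using integrable_bump_times[OF eps, of "\<lambda>t. inner g t + c"] by (simp add: continuous_intros)
  have eq: "mollify \<epsilon> f y = inner g y + d" if y: "y \<in> ball x \<epsilon>" for y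
  proof -
    have "bump \<epsilon> t * f (y + t) = bump \<epsilon> t * (inner g t + c) + bump \<epsilon> t * inner g y" for t
    proof (cases "norm t < \<epsilon>")
      case True
      have "dist x (y + t) \<le> dist x y + norm t"
        using dist_triangle[of x "y + t" y] by (simp add: dist_norm)
      with True y have "y + t \<in> ball x (2 * \<epsilon>)" by simp
      then show ?thesis using assms by (simp add: inner_add_right algebra_simps)
    next
      case False
      then show ?thesis using bump_eq_0[OF eps, of t] by simp
    qed
    then have "(LINT t|lborel. bump \<epsilon> t * f (y + t))
        = (LINT t|lborel. bump \<epsilon> t * (inner g t + c)) + ?N * inner g y"
      using int integrable_bump by (simp add: Bochner_Integration.integral_add)
    then show ?thesis
      using integral_bump_pos[OF eps] by (simp add: mollify_def d_def add_divide_distrib)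
  qed
  show ?thesis
    by (rule gderiv_affine_on_interior[where e = "ball x \<epsilon>"]) (use eps eq in auto)
qed

text \<open>Translation moves \<open>x\<close> from the merely Lipschitz \<open>f\<close> to the
  differentiable kernel, and the support of \<open>f\<close> gives a fixed box of integration, as
  differentiation under the integral requires.\<close>

lemma mollify_eq_integral:
  assumes supp: "\<And>y. y \<notin> cbox a b \<Longrightarrow> f y = 0"
  shows "mollify \<epsilon> f x = integral (cbox a b) (\<lambda>y. bump \<epsilon> (y - x) * f y) / (LINT t|lborel. bump \<epsilon> t)"
proof -
  define h where "h = (\<lambda>y. bump \<epsilon> (y - x) * f y)"
  have "continuous_on UNIV h"
    unfolding h_def bump_def by (intro continuous_intros lipschitz_continuous)
  then have hm: "h \<in> borel_measurable borel" by (rule borel_measurable_continuous_onI)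
  have hx: "(\<lambda>t. h (x + t)) = (\<lambda>t. bump \<epsilon> t * f (x + t))" by (simp add: h_def)
  have "integrable (distr lborel borel ((+) x)) h"
    using integrable_mollify[of x] hm by (subst integrable_distr_eq) (simp_all add: hx)
  then have int: "integrable lborel h" unfolding lborel_distr_plus .
  have "(LINT t|lborel. bump \<epsilon> t * f (x + t)) = integral\<^sup>L (distr lborel borel ((+) x)) h"
    using hm by (subst integral_distr) (simp_all add: hx)
  then have eq: "(LINT t|lborel. bump \<epsilon> t * f (x + t)) = integral\<^sup>L lborel h"
    unfolding lborel_distr_plus .
  have "h = (\<lambda>y. if y \<in> cbox a b then h y else 0)"
    using supp by (auto simp: h_def fun_eq_iff)
  then have "((\<lambda>y. if y \<in> cbox a b then h y else 0) has_integral integral\<^sup>L lborel h) UNIV"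
    using has_integral_integral_lborel[OF int] by simp
  then have "(h has_integral integral\<^sup>L lborel h) (cbox a b)"
    by (simp only: has_integral_restrict_UNIV)
  then have "integral (cbox a b) h = integral\<^sup>L lborel h" by (rule integral_unique)
  then show ?thesis by (simp add: mollify_def eq h_def)
qed

lemma mollify_gradient:
  assumes supp: "\<And>y. y \<notin> cbox a b \<Longrightarrow> f y = 0"
  obtains D where "continuous_on UNIV D" "\<And>x. GDERIV (mollify \<epsilon> f) x :> D x"
proof -
  let ?N = "LINT t|lborel. bump \<epsilon> t"
  define B where "B x t = (4 * max 0 (\<epsilon>\<^sup>2 - inner (t - x) (t - x)) * f t) *\<^sub>R blinfun_inner_right (t - x)"
    for x t :: plane
  define I where "I x = integral (cbox a b) (B x)" for x
  have cont: "continuous_on (UNIV \<times> cbox a b) (\<lambda>(x, t). B x t)"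
    unfolding B_def case_prod_beta
    by (intro continuous_intros bounded_linear.continuous_on[OF bounded_linear_blinfun_inner_right]
        continuous_on_compose2[OF lipschitz_continuous[of UNIV]]) auto
  have deriv: "((\<lambda>x. integral (cbox a b) (\<lambda>y. bump \<epsilon> (y - x) * f y)) has_derivative I x) (at x)" for x
    unfolding I_def
  proof (rule leibniz_rule[where U = UNIV, OF _ _ cont])
    fix x t
    have "((\<lambda>x. bump \<epsilon> (t - x) * f t) has_derivative
        (\<lambda>h. 4 * max 0 (\<epsilon>\<^sup>2 - inner (t - x) (t - x)) * inner (t - x) h * f t)) (at x)"
      by (rule has_derivative_mult_left[OF has_derivative_bump])
    moreover have "blinfun_apply (B x t)
        = (\<lambda>h. 4 * max 0 (\<epsilon>\<^sup>2 - inner (t - x) (t - x)) * inner (t - x) h * f t)"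
      by (simp add: B_def blinfun.scaleR_left mult_ac fun_eq_iff)
    ultimately show "((\<lambda>x. bump \<epsilon> (t - x) * f t) has_derivative blinfun_apply (B x t)) (at x)"
      by (simp only:)
    show "(\<lambda>y. bump \<epsilon> (y - x) * f y) integrable_on cbox a b"
      unfolding bump_def by (intro integrable_continuous continuous_intros lipschitz_continuous)
  qed auto
  \<comment> \<open>The vector that represents the functional \<open>I x\<close>, up to
    normalisation.\<close>
  define D where "D x = (1 / ?N) *\<^sub>R (\<Sum>i\<in>Basis. blinfun_apply (I x) i *\<^sub>R i)" for x
  have expand: "inner h (\<Sum>i\<in>Basis. blinfun_apply (I x) i *\<^sub>R i) = blinfun_apply (I x) h" for x h
  proof -
    have "blinfun_apply (I x) h = blinfun_apply (I x) (\<Sum>i\<in>Basis. inner h i *\<^sub>R i)"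
      by (simp only: euclidean_representation)
    also have "\<dots> = (\<Sum>i\<in>Basis. inner h i * blinfun_apply (I x) i)"
      by (simp add: blinfun.sum_right blinfun.scaleR_right)
    finally show ?thesis by (simp add: inner_sum_right mult.commute)
  qed
  show ?thesis
  proof
    have "continuous_on UNIV I"
      unfolding I_def using integral_continuous_on_param[OF cont] .
    then show "continuous_on UNIV D" unfolding D_def by (intro continuous_intros)
    fix x
    have "((\<lambda>x. integral (cbox a b) (\<lambda>y. bump \<epsilon> (y - x) * f y) / ?N) has_derivative
        (\<lambda>h. blinfun_apply (I x) h / ?N)) (at x)"
      by (rule bounded_linear.has_derivative[OF bounded_linear_divide deriv])
    moreover have "(\<lambda>h. blinfun_apply (I x) h / ?N) = (\<lambda>h. inner h (D x))"
      by (simp add: D_def expand)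
    moreover have "mollify \<epsilon> f = (\<lambda>x. integral (cbox a b) (\<lambda>y. bump \<epsilon> (y - x) * f y) / ?N)"
      by (intro ext mollify_eq_integral supp)
    ultimately show "GDERIV (mollify \<epsilon> f) x :> D x" by (simp only: gderiv_def)
  qed
qed

end

text \<open>Difference quotients along \<open>D\<close> itself tend to the squared length of
  \<open>D\<close> and are bounded by \<open>M * norm D\<close>.\<close>

lemma gderiv_norm_le_lipschitz:
  fixes w :: "'a::real_inner \<Rightarrow> real"
  assumes "GDERIV w x :> D" "\<And>y. \<bar>w x - w y\<bar> \<le> M * dist x y" "0 \<le> M"
  shows "norm D \<le> M"
proof -
  have line: "((\<lambda>t::real. x + t *\<^sub>R D) has_derivative (\<lambda>t. t *\<^sub>R D)) (at 0)"
    by (auto intro!: derivative_eq_intros)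
  have "(w has_derivative (\<lambda>h. inner h D)) (at (x + (0::real) *\<^sub>R D))"
    using assms(1) by (simp add: gderiv_def)
  from has_derivative_compose[OF line this]
  have "((\<lambda>t. w (x + t *\<^sub>R D)) has_field_derivative inner D D) (at 0)"
    by (simp add: has_field_derivative_def mult.commute[of _ "inner D D"])
  then have lim: "((\<lambda>t. (w (x + t *\<^sub>R D) - w x) / t) \<longlongrightarrow> inner D D) (at 0)"
    by (simp add: DERIV_def)
  have le: "(w (x + t *\<^sub>R D) - w x) / t \<le> M * norm D" for t
  proof -
    have "\<bar>w (x + t *\<^sub>R D) - w x\<bar> \<le> M * norm D * \<bar>t\<bar>"
      using assms(2)[of "x + t *\<^sub>R D"] by (simp add: dist_norm abs_minus_commute mult_ac)
    then have "\<bar>(w (x + t *\<^sub>R D) - w x) / t\<bar> \<le> M * norm D"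
      if "t \<noteq> 0" using that by (simp add: pos_divide_le_eq abs_divide)
    moreover have "0 \<le> M * norm D" using assms(3) by simp
    ultimately show ?thesis by (cases "t = 0") (simp, blast intro: order.trans[OF abs_ge_self])
  qed
  have "inner D D \<le> M * norm D"
    by (rule tendsto_upperbound[OF lim always_eventually]) (use le in simp_all)
  then have "norm D * norm D \<le> M * norm D" by (simp add: dot_square_norm power2_eq_square)
  then show ?thesis using assms(3) by (cases "D = 0") simp_all
qed


section \<open>Membership in \<open>H\<^sub>0\<^sup>1\<close>\<close>

text \<open>Subtracting the truncation of \<open>s\<close> to the interval from
  \<open>- \<delta>\<close> to \<open>\<delta>\<close> shrinks \<open>s\<close> towards zero. Small
  values vanish, large ones are shifted by a constant so that gradients survive, and Lipschitz
  constants do not grow.\<close>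

definition soft_threshold :: "real \<Rightarrow> real \<Rightarrow> real" where
  "soft_threshold \<delta> s = s - max (- \<delta>) (min \<delta> s)"

lemma soft_threshold_contraction: "0 \<le> \<delta> \<Longrightarrow> \<bar>soft_threshold \<delta> s - soft_threshold \<delta> t\<bar> \<le> \<bar>s - t\<bar>"
  unfolding soft_threshold_def max_def min_def by (simp split: if_splits)

lemma soft_threshold_close: "0 \<le> \<delta> \<Longrightarrow> \<bar>soft_threshold \<delta> s - s\<bar> \<le> \<delta>"
  unfolding soft_threshold_def max_def min_def by auto

lemma soft_threshold_eq:
  "0 \<le> \<delta> \<Longrightarrow> \<bar>s\<bar> \<le> \<delta> \<Longrightarrow> soft_threshold \<delta> s = 0"
  "0 \<le> \<delta> \<Longrightarrow> \<delta> \<le> s \<Longrightarrow> soft_threshold \<delta> s = s - \<delta>"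
  "0 \<le> \<delta> \<Longrightarrow> s \<le> - \<delta> \<Longrightarrow> soft_threshold \<delta> s = s + \<delta>"
  unfolding soft_threshold_def max_def min_def by auto

text \<open>Thresholding first makes the support a compact subset of the domain, at a distance from the
  boundary that the mollification radius can be chosen to respect.\<close>

lemma lipschitz_locally_affine_in_H10:
  fixes v :: "plane \<Rightarrow> real" and G :: "plane \<Rightarrow> plane"
  assumes \<Omega>: "open \<Omega>" "bounded \<Omega>" and lip: "M-lipschitz_on UNIV v"
    and zero: "\<And>x. x \<notin> \<Omega> \<Longrightarrow> v x = 0"
    and G: "G \<in> borel_measurable lebesgue"
    and AE: "AE x in lebesgue. x \<in> \<Omega> \<longrightarrow>
      (\<exists>r>0. \<exists>c. \<forall>y\<in>ball x r. v y = inner (G x) y + c) \<and> (v x = 0 \<longrightarrow> G x = 0)"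
  shows "v \<in> H10 \<Omega>"
proof -
  let ?L = "lebesgue_on \<Omega>"
  have M: "0 \<le> M" using lip by (rule lipschitz_on_nonneg)
  have vle: "\<bar>v x - v y\<bar> \<le> M * dist x y" for x y
    using lipschitz_onD[OF lip, of x y] by (simp add: dist_real_def)
  have v_cont: "continuous_on UNIV v" using lip by (rule lipschitz_on_continuous_on)
  have \<Omega>m: "\<Omega> \<in> sets lebesgue" using \<Omega>(1) by simp
  have \<Omega>l: "\<Omega> \<in> lmeasurable" using \<Omega> by (simp add: lmeasurable_open)
  interpret fin: finite_measure ?L using \<Omega>l by (rule finite_measure_lebesgue_on)
  have meas: "f \<in> borel_measurable ?L" if "continuous_on UNIV f" for f :: "plane \<Rightarrow> 'b::euclidean_space"
    using \<Omega>m that continuous_on_subset by (intro continuous_imp_measurable_on_sets_lebesgue) blast+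
  have G_meas: "G \<in> borel_measurable ?L" using G by (rule measurable_restrict_space1)
  obtain a b where ab: "\<Omega> \<subseteq> cbox a b" using \<Omega>(2) bounded_subset_cbox_symmetric by metis
  define \<delta> where "\<delta> n = 1 / (real n + 1)" for n
  \<comment> \<open>Chosen so that \<open>(M + 1) * \<epsilon> n = \<delta> n / 2\<close>: within
    the mollification radius \<open>v\<close> varies by at most half the threshold, and the radius
    itself is at most \<open>\<delta> n / 2\<close>.\<close>
  define \<epsilon> where "\<epsilon> n = \<delta> n / (2 * (M + 1))" for n
  define f where "f n x = soft_threshold (\<delta> n) (v x)" for n x
  define w where "w n = mollify (\<epsilon> n) (f n)" for n
  have \<delta>: "0 < \<delta> n" "\<delta> n \<le> 1" for n by (simp_all add: \<delta>_def)
  have \<delta>_lim: "\<delta> \<longlonglongrightarrow> 0"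
    unfolding \<delta>_def using LIMSEQ_inverse_real_of_nat by (simp add: inverse_eq_divide add.commute)
  have \<epsilon>: "0 < \<epsilon> n" for n using \<delta> M by (simp add: \<epsilon>_def add_nonneg_pos)
  have \<epsilon>\<delta>: "\<epsilon> n \<le> \<delta> n / 2" "M * \<epsilon> n \<le> \<delta> n / 2" for n
  proof -
    have cancel: "c * (d / (2 * c)) = d / 2" if "c \<noteq> 0" for c d :: real using that by simp
    have *: "(M + 1) * \<epsilon> n = \<delta> n / 2" unfolding \<epsilon>_def using M by (intro cancel) simp
    have "(M + 1) * \<epsilon> n = M * \<epsilon> n + \<epsilon> n" by (simp add: distrib_right)
    moreover have "0 \<le> M * \<epsilon> n" using M \<epsilon>[of n] by simp
    ultimately show "\<epsilon> n \<le> \<delta> n / 2" "M * \<epsilon> n \<le> \<delta> n / 2" using * \<epsilon>[of n] by linarith+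
  qed
  have f_lip: "M-lipschitz_on UNIV (f n)" for n
  proof (rule lipschitz_onI)
    fix x y
    show "dist (f n x) (f n y) \<le> M * dist x y"
      using soft_threshold_contraction[of "\<delta> n" "v x" "v y"] vle[of x y] \<delta>[of n]
      by (simp add: f_def dist_real_def)
  qed (rule M)
  have f_zero: "f n x = 0" if "\<bar>v x\<bar> \<le> \<delta> n" for n x
    using soft_threshold_eq(1)[OF _ that] \<delta>[of n] by (simp add: f_def)
  have f_supp: "f n y = 0" if "y \<notin> cbox a b" for n y
  proof -
    have "v y = 0" using that ab by (intro zero) blast
    then show ?thesis using \<delta>[of n] by (intro f_zero) simp
  qed
  have "\<exists>D. continuous_on UNIV D \<and> (\<forall>x. GDERIV (w n) x :> D x)" for n
    using mollify_gradient[OF f_lip[of n] \<epsilon>[of n] f_supp[of _ n]] unfolding w_def by metis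
  then obtain D where D_cont: "\<And>n. continuous_on UNIV (D n)" and D: "\<And>n x. GDERIV (w n) x :> D n x"
    by metis
  have grad_w: "grad (w n) = D n" for n
    using D by (intro ext grad_eqI)
  have D_le: "norm (D n x) \<le> M" for n x
    using D mollify_lipschitz[OF f_lip[of n] \<epsilon>[of n], of x] M unfolding w_def
    by (rule gderiv_norm_le_lipschitz)
  have w_close: "\<bar>w n x - v x\<bar> \<le> 2 * \<delta> n" for n x
    using mollify_close[OF f_lip[of n] \<epsilon>[of n], of x] \<epsilon>\<delta>(2)[of n] soft_threshold_close[of "\<delta> n" "v x"] \<delta>[of n]
    unfolding w_def f_def by linarith
  have w_zero: "w n x = 0" if "\<bar>v x\<bar> \<le> \<delta> n / 2" for n x
  proof -
    have "f n (x + t) = 0" if "norm t < \<epsilon> n" for t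
    proof -
      have "M * norm t \<le> M * \<epsilon> n" using that M by (intro mult_left_mono) auto
      moreover have "\<bar>v (x + t) - v x\<bar> \<le> M * norm t" using vle[of "x + t" x] by (simp add: dist_norm)
      ultimately have "\<bar>v (x + t)\<bar> \<le> \<delta> n" using \<open>\<bar>v x\<bar> \<le> \<delta> n / 2\<close> \<epsilon>\<delta>(2)[of n] by linarith
      then show ?thesis by (rule f_zero)
    qed
    then have "\<bar>mollify (\<epsilon> n) (f n) x - (LINT t|lborel. bump (\<epsilon> n) t * 0) / (LINT t|lborel. bump (\<epsilon> n) t)\<bar> \<le> 0"
      by (intro mollify_diff_le[OF f_lip[of n] \<epsilon>[of n]]) auto
    then show ?thesis by (simp add: w_def)
  qed
  have w_C1: "w n \<in> C1_compact_support \<Omega>" for n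
  proof -
    have "w n differentiable at x" for x
      using D[of n x] unfolding gderiv_def differentiable_def by blast
    moreover have "continuous_on UNIV (grad (w n))" unfolding grad_w by (rule D_cont)
    moreover have supp: "closure {x. w n x \<noteq> 0} \<subseteq> {x. \<delta> n / 2 \<le> \<bar>v x\<bar>}"
    proof (rule closure_minimal)
      show "{x. w n x \<noteq> 0} \<subseteq> {x. \<delta> n / 2 \<le> \<bar>v x\<bar>}"         using w_zero[of _ n] by (metis (mono_tags, lifting) linorder_le_cases mem_Collect_eq subsetI)
      show "closed {x. \<delta> n / 2 \<le> \<bar>v x\<bar>}" using v_cont by (intro closed_Collect_le continuous_intros)
    qed
    moreover have sub: "{x. \<delta> n / 2 \<le> \<bar>v x\<bar>} \<subseteq> \<Omega>" 
    proof
      fix x assume "x \<in> {x. \<delta> n / 2 \<le> \<bar>v x\<bar>}"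
      then have "v x \<noteq> 0" using \<delta>[of n] by auto
      then show "x \<in> \<Omega>" using zero by blast
    qed
    moreover have "compact (closure {x. w n x \<noteq> 0})"
      using bounded_subset[OF \<Omega>(2)] supp sub by (simp add: compact_eq_bounded_closed subset_trans)
    ultimately show ?thesis unfolding C1_compact_support_def by blast
  qed
  have AE_L: "AE x in ?L. (\<exists>r>0. \<exists>c. \<forall>y\<in>ball x r. v y = inner (G x) y + c) \<and> (v x = 0 \<longrightarrow> G x = 0)"
    using AE \<Omega>m by (subst AE_restrict_space_iff) auto
  \<comment> \<open>The gradients do not merely converge: almost everywhere they are eventually
    equal to \<open>G x\<close>, since near \<open>x\<close> the threshold either erases
    \<open>v\<close> or shifts it by a constant, and mollification keeps affine gradients.\<close>
  have D_lim: "AE x in ?L. eventually (\<lambda>n. D n x = G x) sequentially"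
    using AE_L
  proof eventually_elim
    case (elim x)
    then obtain r c where r: "0 < r" and affine: "\<And>y. y \<in> ball x r \<Longrightarrow> v y = inner (G x) y + c"
      and G0: "v x = 0 \<Longrightarrow> G x = 0" by blast
    have grad_f: "D n x = G x" if "\<And>y. y \<in> ball x (2 * \<epsilon> n) \<Longrightarrow> f n y = inner (G x) y + d" for n d
      using grad_eqI[OF mollify_affine[OF f_lip[of n] \<epsilon>[of n] that]] grad_w[of n] by (simp add: w_def)
    have small: "eventually (\<lambda>n. \<delta> n < t) sequentially" if "0 < t" for t
      using order_tendstoD(2)[OF \<delta>_lim that] .
    show ?case
    proof (cases "v x = 0")
      case True
      have "c = 0" using affine[of x] r True G0 by simp
      then have v0: "v y = 0" if "y \<in> ball x r" for y using affine[OF that] G0[OF True] by simp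
      show ?thesis using small[OF r]
      proof eventually_elim
        case (elim n)
        have "f n y = inner (G x) y + 0" if "y \<in> ball x (2 * \<epsilon> n)" for y
        proof -
          have "y \<in> ball x r" using that \<epsilon>\<delta>(1)[of n] elim by simp
          then show ?thesis using v0 f_zero[of y n] \<delta>[of n] G0[OF True] by simp
        qed
        then show ?case by (rule grad_f)
      qed
    next
      case False
      \<comment> \<open>As soon as \<open>\<delta> n < t\<close>, the ball of radius
        \<open>2 * \<epsilon> n\<close> stays in the affine neighbourhood and \<open>v\<close> keeps
        on it the sign of \<open>v x\<close> and modulus at least \<open>\<delta> n\<close>.\<close>
      define t where "t = min r (\<bar>v x\<bar> / (M + 1))"
      have t: "0 < t" "t \<le> r" "(M + 1) * t \<le> \<bar>v x\<bar>"
      proof -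
        have M1: "0 < M + 1" using M by simp
        have "0 < \<bar>v x\<bar> / (M + 1)" using False M1 by (intro divide_pos_pos) auto
        then show "0 < t" "t \<le> r" using r by (simp_all add: t_def)
        have "(M + 1) * t \<le> (M + 1) * (\<bar>v x\<bar> / (M + 1))"
          using M1 by (intro mult_left_mono) (auto simp: t_def)
        then show "(M + 1) * t \<le> \<bar>v x\<bar>" using M1 by simp
      qed
      show ?thesis using small[OF t(1)]
      proof eventually_elim
        case (elim n)
        have near: "y \<in> ball x r" "\<bar>v y - v x\<bar> \<le> \<bar>v x\<bar> - \<delta> n" if "y \<in> ball x (2 * \<epsilon> n)" for y
        proof -
          have d: "dist x y \<le> \<delta> n" using that \<epsilon>\<delta>(1)[of n] by simp
          then show "y \<in> ball x r" using elim t(2) by simp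
          have "\<bar>v y - v x\<bar> \<le> M * \<delta> n"
            using vle[of x y] mult_left_mono[OF d M] by linarith
          moreover have "(M + 1) * \<delta> n \<le> (M + 1) * t" using elim M by (intro mult_left_mono) auto
          ultimately show "\<bar>v y - v x\<bar> \<le> \<bar>v x\<bar> - \<delta> n" using t(3) by (simp add: distrib_right)
        qed
        show ?case
        proof (cases "0 < v x")
          case True
          have "f n y = inner (G x) y + (c - \<delta> n)" if "y \<in> ball x (2 * \<epsilon> n)" for y
          proof -
            have "\<delta> n \<le> v y" using near(2)[OF that] True by linarith
            then show ?thesis
              using soft_threshold_eq(2)[of "\<delta> n" "v y"] \<delta>[of n] affine[OF near(1)[OF that]] by (simp add: f_def)
          qed
          then show ?thesis by (rule grad_f)
        next
          case neg: False
          have "f n y = inner (G x) y + (c + \<delta> n)" if "y \<in> ball x (2 * \<epsilon> n)" for y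
          proof -
            have "v y \<le> - \<delta> n" using near(2)[OF that] neg False by linarith
            then show ?thesis
              using soft_threshold_eq(3)[of "\<delta> n" "v y"] \<delta>[of n] affine[OF near(1)[OF that]] by (simp add: f_def)
          qed
          then show ?thesis by (rule grad_f)
        qed
      qed
    qed
  qed
  \<comment> \<open>Eventual equality transfers the bound from the mollified gradients to
    \<open>G\<close>, which gives both square integrability and a dominating constant.\<close>
  have G_le: "AE x in ?L. norm (G x) \<le> M"
    using D_lim
  proof eventually_elim
    case (elim x)
    then obtain n where "D n x = G x" by (auto simp: eventually_sequentially)
    with D_le[of n x] show ?case by simp
  qed
  have sq: "square_integrable_on \<Omega> h" if h: "h \<in> borel_measurable ?L" "AE x in ?L. norm (h x) \<le> B"
    for h :: "plane \<Rightarrow> 'c::euclidean_space" and B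
  proof -
    have "AE x in ?L. norm ((norm (h x))\<^sup>2) \<le> B\<^sup>2"
      using h(2)
    proof eventually_elim
      case (elim x)
      then have "(norm (h x))\<^sup>2 \<le> B\<^sup>2" by (intro power_mono) auto
      then show ?case by simp
    qed
    moreover have "(\<lambda>x. (norm (h x))\<^sup>2) \<in> borel_measurable ?L"
      by (intro borel_measurable_power measurable_compose[OF h(1) borel_measurable_norm])
    ultimately have "integrable ?L (\<lambda>x. (norm (h x))\<^sup>2)" by (rule fin.integrable_const_bound)
    with h(1) show ?thesis unfolding square_integrable_on_def by blast
  qed
  have sq_v: "square_integrable_on \<Omega> v"
  proof -
    have "bounded (v ` cbox a b)"
      using compact_continuous_image[OF continuous_on_subset[OF v_cont] compact_cbox] compact_imp_bounded by blast
    then obtain B where B: "\<And>y. y \<in> cbox a b \<Longrightarrow> norm (v y) \<le> B" unfolding bounded_iff by blast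
    have "AE x in ?L. norm (v x) \<le> B"
      using B ab by (intro AE_I2) (auto simp: space_restrict_space)
    with meas[OF v_cont] show ?thesis by (rule sq)
  qed
  have sq_G: "square_integrable_on \<Omega> G" using G_meas G_le by (rule sq)
  have w_cont: "continuous_on UNIV (w n)" for n
    using D[of n] unfolding gderiv_def
    by (intro continuous_at_imp_continuous_on ballI has_derivative_continuous) blast
  \<comment> \<open>The dominating constant 4 is the square of \<open>2 * \<delta> n\<close> at its
    largest, \<open>\<delta> n = 1\<close>.\<close>
  have lim_w: "(\<lambda>n. LINT x|?L. (w n x - v x)\<^sup>2) \<longlonglongrightarrow> (LINT x|?L. (0::real))"
  proof (rule integral_dominated_convergence[where w = "\<lambda>_. 4"])
    show "(\<lambda>x. (w n x - v x)\<^sup>2) \<in> borel_measurable ?L" for n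
      by (intro meas continuous_intros w_cont v_cont)
    show "AE x in ?L. (\<lambda>n. (w n x - v x)\<^sup>2) \<longlonglongrightarrow> 0"
    proof (intro AE_I2)
      fix x
      have "eventually (\<lambda>n. norm (w n x - v x) \<le> 2 * \<delta> n) sequentially"
        unfolding real_norm_def by (intro always_eventually allI w_close)
      moreover have "(\<lambda>n. 2 * \<delta> n) \<longlonglongrightarrow> 0" using \<delta>_lim by (rule tendsto_mult_right_zero)
      ultimately have "(\<lambda>n. w n x - v x) \<longlonglongrightarrow> 0" by (rule Lim_null_comparison)
      from tendsto_power[OF this, of 2] show "(\<lambda>n. (w n x - v x)\<^sup>2) \<longlonglongrightarrow> 0" by simp
    qed
    show "AE x in ?L. norm ((w n x - v x)\<^sup>2) \<le> 4" for n
    proof (intro AE_I2)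
      fix x
      have "\<bar>w n x - v x\<bar> \<le> 2" using w_close[of n x] \<delta>(2)[of n] by linarith
      then have "\<bar>w n x - v x\<bar>\<^sup>2 \<le> 2\<^sup>2" by (rule power_mono) simp
      then show "norm ((w n x - v x)\<^sup>2) \<le> 4" by simp
    qed
  qed auto
  have lim_D: "(\<lambda>n. LINT x|?L. (norm (D n x - G x))\<^sup>2) \<longlonglongrightarrow> (LINT x|?L. (0::real))"
  proof (rule integral_dominated_convergence[where w = "\<lambda>_. (2 * M)\<^sup>2"])
    show "(\<lambda>x. (norm (D n x - G x))\<^sup>2) \<in> borel_measurable ?L" for n
      by (intro borel_measurable_power
          measurable_compose[OF borel_measurable_diff[OF meas[OF D_cont] G_meas] borel_measurable_norm])
    show "AE x in ?L. (\<lambda>n. (norm (D n x - G x))\<^sup>2) \<longlonglongrightarrow> 0"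
      using D_lim
    proof eventually_elim
      case (elim x)
      then have "eventually (\<lambda>n. (norm (D n x - G x))\<^sup>2 = 0) sequentially"
        by eventually_elim simp
      then show ?case by (rule tendsto_eventually)
    qed
    show "AE x in ?L. norm ((norm (D n x - G x))\<^sup>2) \<le> (2 * M)\<^sup>2" for n
      using G_le
    proof eventually_elim
      case (elim x)
      have "norm (D n x - G x) \<le> 2 * M"
        using norm_triangle_ineq4[of "D n x" "G x"] D_le[of n x] elim by linarith
      then have "(norm (D n x - G x))\<^sup>2 \<le> (2 * M)\<^sup>2" by (intro power_mono) auto
      then show ?case by simp
    qed
  qed auto
  have "\<exists>g \<phi>. square_integrable_on \<Omega> g \<and> (\<forall>n. \<phi> n \<in> C1_compact_support \<Omega>) \<and>
      (\<lambda>n. LINT x|?L. (\<phi> n x - v x)\<^sup>2) \<longlonglongrightarrow> 0 \<and>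
      (\<lambda>n. LINT x|?L. (norm (grad (\<phi> n) x - g x))\<^sup>2) \<longlonglongrightarrow> 0"
  proof (intro exI[of _ G] exI[of _ w] conjI allI sq_G w_C1)
    show "(\<lambda>n. LINT x|?L. (w n x - v x)\<^sup>2) \<longlonglongrightarrow> 0" using lim_w by simp
    show "(\<lambda>n. LINT x|?L. (norm (grad (w n) x - G x))\<^sup>2) \<longlonglongrightarrow> 0"
      unfolding grad_w using lim_D by simp
  qed
  with sq_v show ?thesis unfolding H10_def by blast
qed

section \<open>Stiffness matrices\<close>

lemma symmetric_matI:
  fixes K :: "real Matrix.mat"
  assumes K: "K \<in> carrier_mat n n"
    and sym: "\<And>x y. x \<in> carrier_vec n \<Longrightarrow> y \<in> carrier_vec n \<Longrightarrow>
      scalar_prod x (K *\<^sub>v y) = scalar_prod y (K *\<^sub>v x)"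
  shows "transpose_mat K = K"
proof (rule eq_matI)
  have entry: "scalar_prod (unit_vec n i) (K *\<^sub>v unit_vec n j) = K $$ (i, j)" if "i < n" "j < n" for i j
    using K that by (simp add: scalar_prod_left_unit scalar_prod_right_unit[of _ n])
  fix i j assume "i < dim_row K" "j < dim_col K"
  then have ij: "i < n" "j < n" using K by auto
  then show "transpose_mat K $$ (i, j) = K $$ (i, j)"
    using entry[OF ij] entry[OF ij(2,1)] sym[of "unit_vec n i" "unit_vec n j"] K by simp
qed (use K in auto)

context mesh
begin

lemma fe_space_piecewise_affine: "v \<in> fe_space \<Omega> \<T> \<Longrightarrow> piecewise_affine v"
  unfolding fe_space_def piecewise_affine_def by blast

text \<open>This transfers inequalities between the bilinear forms on the space to inequalities
  between the matrices on all vectors. Here the interpolation of nodal values and the membership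
  criterion for \<open>H10\<close> come together.\<close>

lemma dofs_surjective:
  assumes xs: "node_enumeration \<Omega> \<T> xs" and y: "y \<in> carrier_vec (length xs)"
  obtains v where "v \<in> fe_space \<Omega> \<T>" "dofs xs v = y"
proof -
  have dist: "distinct xs" and set: "set xs = interior_vertices \<Omega> \<T>"
    using xs unfolding node_enumeration_def by blast+
  define f where "f x = (if x \<in> set xs then vec_index y (SOME i. i < length xs \<and> xs ! i = x) else 0)" for x
  have f: "f (xs ! i) = vec_index y i" if i: "i < length xs" for i
  proof -
    have "(SOME j. j < length xs \<and> xs ! j = xs ! i) = i"
      using i dist by (intro some_equality) (auto simp: nth_eq_iff_index_eq)
    then show ?thesis using i by (simp add: f_def)
  qed
  have "f x = 0" if "x \<notin> \<Omega>" for x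
    using that set unfolding f_def interior_vertices_def by auto
  then obtain v where v: "piecewise_affine v" "\<And>x. x \<notin> \<Omega> \<Longrightarrow> v x = 0"
    "\<And>e x. e \<in> \<T> \<Longrightarrow> x extreme_point_of e \<Longrightarrow> v x = f x"
    using nodal_interpolant[of f] by metis
  obtain M where M: "M-lipschitz_on UNIV v" using piecewise_affine_lipschitz[OF v(1,2)] by metis
  have "v \<in> H10 \<Omega>"
    by (rule lipschitz_locally_affine_in_H10[OF domain_open domain_bounded M v(2) AE_locally_affine[OF v(1)]])
  then have "v \<in> fe_space \<Omega> \<T>"
    using v(1) unfolding fe_space_def piecewise_affine_def by blast
  moreover have "dofs xs v = y"
  proof (rule eq_vecI)
    show "dim_vec (dofs xs v) = dim_vec y" using y by (simp add: dofs_def)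
    fix i assume "i < dim_vec y"
    then have i: "i < length xs" using y by simp
    then have "xs ! i \<in> interior_vertices \<Omega> \<T>" using set nth_mem by blast
    then have "v (xs ! i) = f (xs ! i)" using v(3) unfolding interior_vertices_def by blast
    then show "vec_index (dofs xs v) i = vec_index y i"
      using i f[OF i] by (simp add: dofs_def vec_of_list_index)
  qed
  ultimately show ?thesis using that by blast
qed

lemma stiffness_matrix_symmetric:
  assumes xs: "node_enumeration \<Omega> \<T> xs" and K: "stiffness_matrix (fe_space \<Omega> \<T>) xs a K"
    and sym: "\<And>u v. a u v = a v u"
  shows "K \<in> carrier_mat (length xs) (length xs)" "transpose_mat K = K"
proof -
  show Kc: "K \<in> carrier_mat (length xs) (length xs)" using K by (simp add: stiffness_matrix_def)
  show "transpose_mat K = K"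
  proof (rule symmetric_matI[OF Kc])
    fix x y :: "real Matrix.vec"
    assume x: "x \<in> carrier_vec (length xs)" and y: "y \<in> carrier_vec (length xs)"
    obtain u where u: "u \<in> fe_space \<Omega> \<T>" "dofs xs u = x" by (rule dofs_surjective[OF xs x])
    obtain v where v: "v \<in> fe_space \<Omega> \<T>" "dofs xs v = y" by (rule dofs_surjective[OF xs y])
    have "scalar_prod x (K *\<^sub>v y) = a u v" "scalar_prod y (K *\<^sub>v x) = a v u"
      using K u v unfolding stiffness_matrix_def by blast+
    then show "scalar_prod x (K *\<^sub>v y) = scalar_prod y (K *\<^sub>v x)" using sym by simp
  qed
qed

end

lemma fem_form_commute: "fem_form \<Omega> u v = fem_form \<Omega> v u"
  unfolding fem_form_def by (simp add: inner_commute)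

lemma sse_form_commute: "sse_form \<T> p u v = sse_form \<T> p v u"
  unfolding sse_form_def by (simp add: inner_commute)

theorem corollary3p5:
  fixes \<Omega> :: "plane set" and H :: "real set" and T :: "real \<Rightarrow> plane set set"
  assumes "polygonal_domain \<Omega>" and "quasi_uniform_family \<Omega> H T"
  shows "\<exists>C>0. \<forall>h\<in>H. \<forall>p xs K Kbar Minv.
    vertex_numbering (T h) p \<and>
    node_enumeration \<Omega> (T h) xs \<and> xs \<noteq> [] \<and>
    stiffness_matrix (fe_space \<Omega> (T h)) xs (fem_form \<Omega>) K \<and>
    stiffness_matrix (fe_space \<Omega> (T h)) xs (sse_form (T h) p) Kbar \<and>
    spd_mat (length xs) Minv \<longrightarrow>
      cond_number (Minv * Kbar) \<le> C * cond_number (Minv * K)"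
proof -
  \<comment> \<open>Shape regularity is uniform over \<open>H\<close>, so the constant is fixed
    before \<open>h\<close>.\<close>
  obtain \<sigma> where \<sigma>: "0 < \<sigma>" "\<And>h e. h \<in> H \<Longrightarrow> e \<in> T h \<Longrightarrow> diameter e \<le> \<sigma> * inscribed_diameter e"
    using assms(2) unfolding quasi_uniform_family_def by blast
  define c where "c = 1 / (36 * \<sigma>\<^sup>2)"
  have c: "0 < c" using \<sigma>(1) by (simp add: c_def)
  show ?thesis
  proof (rule exI[of _ "4 / c"], intro conjI ballI allI impI)
    show "0 < 4 / c" using c by simp
    fix h p xs K Kbar Minv
    assume h: "h \<in> H" and asm: "vertex_numbering (T h) p \<and> node_enumeration \<Omega> (T h) xs \<and> xs \<noteq> [] \<and>
      stiffness_matrix (fe_space \<Omega> (T h)) xs (fem_form \<Omega>) K \<and>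
      stiffness_matrix (fe_space \<Omega> (T h)) xs (sse_form (T h) p) Kbar \<and> spd_mat (length xs) Minv"
    then have xs: "node_enumeration \<Omega> (T h) xs" and num: "vertex_numbering (T h) p"
      and K: "stiffness_matrix (fe_space \<Omega> (T h)) xs (fem_form \<Omega>) K"
      and Kbar: "stiffness_matrix (fe_space \<Omega> (T h)) xs (sse_form (T h) p) Kbar"
      and spd: "spd_mat (length xs) Minv" and n: "0 < length xs" by auto
    have "triangulation_of \<Omega> (T h)" using assms(2) h unfolding quasi_uniform_family_def by blast
    with assms(1) num interpret numbered_mesh \<Omega> "T h" p
      by (intro numbered_mesh.intro mesh.intro numbered_mesh_axioms.intro)
    have forms: "\<exists>u. piecewise_affine u \<and> scalar_prod x (K *\<^sub>v x) = fem_form \<Omega> u u \<and>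
        scalar_prod x (Kbar *\<^sub>v x) = sse_form (T h) p u u" if x: "x \<in> carrier_vec (length xs)" for x
    proof -
      obtain u where u: "u \<in> fe_space \<Omega> (T h)" "dofs xs u = x" by (rule dofs_surjective[OF xs x])
      have "scalar_prod x (K *\<^sub>v x) = fem_form \<Omega> u u" "scalar_prod x (Kbar *\<^sub>v x) = sse_form (T h) p u u"
        using K Kbar u unfolding stiffness_matrix_def by blast+
      with fe_space_piecewise_affine[OF u(1)] show ?thesis by blast
    qed
    show "cond_number (Minv * Kbar) \<le> 4 / c * cond_number (Minv * K)"
    proof (rule cond_number_spectrally_equivalent[OF n spd])
      show "K \<in> carrier_mat (length xs) (length xs)" "transpose_mat K = K"
        using stiffness_matrix_symmetric[OF xs K fem_form_commute] by blast+
      show "Kbar \<in> carrier_mat (length xs) (length xs)" "transpose_mat Kbar = Kbar"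
        using stiffness_matrix_symmetric[OF xs Kbar sse_form_commute] by blast+
      show "0 < c" "0 < (4::real)" using c by simp_all
      fix x :: "real Matrix.vec" assume "x \<in> carrier_vec (length xs)"
      then obtain u where u: "piecewise_affine u" "scalar_prod x (K *\<^sub>v x) = fem_form \<Omega> u u"
        "scalar_prod x (Kbar *\<^sub>v x) = sse_form (T h) p u u" using forms by blast
      show "0 \<le> scalar_prod x (K *\<^sub>v x)"
        unfolding u(2) fem_form_self[OF u(1)] using element_area_pos
        by (intro sum_nonneg mult_nonneg_nonneg) (auto simp: less_imp_le)
      show "c * scalar_prod x (K *\<^sub>v x) \<le> scalar_prod x (Kbar *\<^sub>v x)"
        unfolding u(2,3) c_def by (rule fem_form_le_sse_form[OF u(1) \<sigma>(1) \<sigma>(2)[OF h]])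
      show "scalar_prod x (Kbar *\<^sub>v x) \<le> 4 * scalar_prod x (K *\<^sub>v x)"
        unfolding u(2,3) by (rule sse_form_le_fem_form[OF u(1)])
    qed
  qed
qed

end
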